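(* Let $F=f+h$ be as in the context, and suppose $f$ is H\"older smooth with exponent $\nu\in[0,1]$ and constant $L_\nu>0$. Let $y_0\in\operatorname{dom}F$ and $\rho>0$. For any $\epsilon\in(0,F(y_0)-F^\star)$, run the PBM variant with absolute error test, started at $y_0$ with parameter $\rho$ and tolerances $\epsilon_k=\epsilon/2$ for all $k\ge0$. Define $$d_0:=\operatorname{dist}(y_0,X^\star),\qquad \Phi_0:=F(y_0)-F^\star,\qquad R_0:=\frac{\Phi_0}{\rho d_0^2}.$$ Then the method generates an outer iterate $y_k$ satisfying $F(y_k)-F^\star\le\epsilon$ within at most $T_{\mathrm{total}}$ inner iterations in total, where: (i) If $\nu=1$, $$T_{\mathrm{total}}\le\left\lceil\frac{\rho d_0^2}{\epsilon}\right\rceil\left[3+\frac{2\log(1+L_1/\rho)+\log(3+2R_0)}{\log(1+\rho/L_1)}\right].$$ (ii) If $\nu\in[0,1)$, $$T_{\mathrm{total}}\le\left\lceil\frac{\rho d_0^2}{\epsilon}\right\rceil\left[3+4\log(3+2R_0)+\frac{8}{1-\nu}\left(\frac{2}{1+\nu}\right)^{\frac{1-\nu}{1+\nu}}\frac{L_\nu^{\frac{2}{1+\nu}}}{\rho\,\epsilon^{\frac{1-\nu}{1+\nu}}}\right].$$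
   Context: Problem. $F=f+h$ on $\mathbb{R}^n$, where $f:\mathbb{R}^n\to\mathbb{R}$ is finite-valued and convex and $h:\mathbb{R}^n\to\mathbb{R}\cup\{+\infty\}$ is proper, lower semicontinuous and convex. $F$ attains its minimum value $F^\star$; $X^\star=\{x\mid F(x)=F^\star\}\neq\emptyset$. $\partial$ is the convex subdifferential, $\|\cdot\|$ the Euclidean norm, $\operatorname{dist}(x,X^\star)$ the Euclidean distance. H\"older smoothness with exponent $\nu\in[0,1]$ and constant $L_\nu$: $\|g_x-g_y\|\le L_\nu\|x-y\|^\nu$ for all $x,y\in\mathbb{R}^n$ and all $g_x\in\partial f(x)$, $g_y\in\partial f(y)$ (for $\nu=0$ the right-hand side is $L_0$). Inner procedure ProxBundle with center $\bar x\in\operatorname{dom}F$, parameter $\rho>0$ and a stopping test. Set $z_0=\bar x$. For $j=0,1,2,\dots$: choose any convex model $f_j:\mathbb{R}^n\to\mathbb{R}$ such that (1) $f_j(x)\le f(x)$ for all $x$; (2) for some $g_j\in\partial f(z_j)$, $f_j(x)\ge f(z_j)+\langle g_j,x-z_j\rangle$ for all $x$; (3) if $j\ge1$, there exist $a_j\in\partial f_{j-1}(z_j)$ and $b_j\in\partial h(z_j)$ with $a_j+b_j=\rho(\bar x-z_j)$ such that $f_j(x)\ge f_{j-1}(z_j)+\langle a_j,x-z_j\rangle$ for all $x$. Let $F_j=f_j+h$ and $z_{j+1}=\arg\min_x\{F_j(x)+\frac{\rho}{2}\|x-\bar x\|^2\}$, and let $e_j=f(z_{j+1})-f_j(z_{j+1})$.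 If the stopping test holds, stop and return $z_{j+1}$; otherwise continue with $j+1$. Each value of $j$ is one inner iteration. PBM variant with absolute error test: given $y_0\in\operatorname{dom}F$, $\rho>0$ and positive tolerances $\{\epsilon_k\}_{k\ge0}$, for $k=0,1,2,\dots$ (outer iterations) let $y_{k+1}$ be the output of ProxBundle with center $\bar x=y_k$ and stopping test $e_j\le\epsilon_k$. *)

theory Defs
  imports "HOL-Analysis.Analysis"
begin

definition effective_domain :: "('a \<Rightarrow> ereal) \<Rightarrow> 'a set" where
  "effective_domain h = {x. h x < \<infinity>}"

definition proper_fun :: "('a \<Rightarrow> ereal) \<Rightarrow> bool" where
  "proper_fun h \<longleftrightarrow> effective_domain h \<noteq> {} \<and> (\<forall>x. h x \<noteq> -\<infinity>)"

definition lower_semicontinuous :: "('a::topological_space \<Rightarrow> ereal) \<Rightarrow> bool" where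
  "lower_semicontinuous h \<longleftrightarrow> (\<forall>x. h x \<le> Liminf (at x) h)"

text \<open>Used only for functions that never take the value \<open>-\<infinity>\<close>, so no sum
  \<open>\<infinity> + -\<infinity>\<close> occurs; for weight 0 the convention \<open>0 * \<infinity> = 0\<close> makes
  the inequality trivially true.\<close>

definition convex_ereal :: "('a::real_vector \<Rightarrow> ereal) \<Rightarrow> bool" where
  "convex_ereal h \<longleftrightarrow>
     (\<forall>x y u v. 0 \<le> u \<and> 0 \<le> v \<and> u + v = 1 \<longrightarrow>
        h (u *\<^sub>R x + v *\<^sub>R y) \<le> ereal u * h x + ereal v * h y)"

definition subdifferential :: "('a::real_inner \<Rightarrow> ereal) \<Rightarrow> 'a \<Rightarrow> 'a set" where
  "subdifferential h x =
     {g. x \<in> effective_domain h \<and> (\<forall>y. h y \<ge> h x + ereal (g \<bullet> (y - x)))}"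

abbreviation subdifferential_real :: "('a::real_inner \<Rightarrow> real) \<Rightarrow> 'a \<Rightarrow> 'a set" where
  "subdifferential_real f \<equiv> subdifferential (\<lambda>x. ereal (f x))"

text \<open>The case \<open>\<nu> = 0\<close> is separate because \<open>0 powr 0 = 0\<close>: for \<open>x = y\<close> the bound
  has to be \<open>L\<close>, not 0.\<close>

definition holder_smooth :: "real \<Rightarrow> real \<Rightarrow> ('a::real_inner \<Rightarrow> real) \<Rightarrow> bool" where
  "holder_smooth \<nu> L f \<longleftrightarrow>
     (\<forall>x y. \<forall>gx \<in> subdifferential_real f x. \<forall>gy \<in> subdifferential_real f y.
        norm (gx - gy) \<le> (if \<nu> = 0 then L else L * norm (x - y) powr \<nu>))"

definition composite :: "('a \<Rightarrow> real) \<Rightarrow> ('a \<Rightarrow> ereal) \<Rightarrow> 'a \<Rightarrow> ereal" where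
  "composite f h x = ereal (f x) + h x"

definition min_value :: "('a \<Rightarrow> ereal) \<Rightarrow> ereal" where
  "min_value F = (INF x. F x)"

definition minimizers :: "('a \<Rightarrow> ereal) \<Rightarrow> 'a set" where
  "minimizers F = {x. F x = min_value F}"

text \<open>In one call of the inner procedure, \<open>m j\<close> is the model \<open>f\<^sub>j\<close> and \<open>z j\<close> the
  point \<open>z\<^sub>j\<close>; \<open>c\<close> is the center.\<close>

definition valid_model ::
  "('a::real_inner \<Rightarrow> real) \<Rightarrow> ('a \<Rightarrow> ereal) \<Rightarrow> real \<Rightarrow> 'a \<Rightarrow>
   (nat \<Rightarrow> 'a \<Rightarrow> real) \<Rightarrow> (nat \<Rightarrow> 'a) \<Rightarrow> nat \<Rightarrow> bool" where
  "valid_model f h \<rho> c m z j \<longleftrightarrow>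
     convex_on UNIV (m j) \<and>
     (\<forall>x. m j x \<le> f x) \<and>
     (\<exists>g \<in> subdifferential_real f (z j). \<forall>x. m j x \<ge> f (z j) + g \<bullet> (x - z j)) \<and>
     (j \<ge> 1 \<longrightarrow>
        (\<exists>a \<in> subdifferential_real (m (j - 1)) (z j). \<exists>b \<in> subdifferential h (z j).
           a + b = \<rho> *\<^sub>R (c - z j) \<and>
           (\<forall>x. m j x \<ge> m (j - 1) (z j) + a \<bullet> (x - z j))))"

definition model_error ::
  "('a \<Rightarrow> real) \<Rightarrow> (nat \<Rightarrow> 'a \<Rightarrow> real) \<Rightarrow> (nat \<Rightarrow> 'a) \<Rightarrow> nat \<Rightarrow> real" where
  "model_error f m z j = f (z (Suc j)) - m j (z (Suc j))"

text \<open>A complete execution of the inner procedure, which may or may not stop. Step \<open>j\<close> is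
  carried out precisely when the test failed at all earlier steps; the entries of \<open>m\<close> and
  \<open>z\<close> beyond the stopping step are unconstrained and irrelevant.\<close>

definition prox_bundle_run ::
  "('a::real_inner \<Rightarrow> real) \<Rightarrow> ('a \<Rightarrow> ereal) \<Rightarrow> real \<Rightarrow> 'a \<Rightarrow> real \<Rightarrow>
   (nat \<Rightarrow> 'a \<Rightarrow> real) \<Rightarrow> (nat \<Rightarrow> 'a) \<Rightarrow> bool" where
  "prox_bundle_run f h \<rho> c tol m z \<longleftrightarrow>
     z 0 = c \<and>
     (\<forall>j. (\<forall>i<j. \<not> model_error f m z i \<le> tol) \<longrightarrow>
        valid_model f h \<rho> c m z j \<and>
        is_arg_min (\<lambda>x. composite (m j) h x + ereal (\<rho> / 2 * (norm (x - c))\<^sup>2))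
          (\<lambda>x. True) (z (Suc j)))"

definition prox_bundle_stops ::
  "('a \<Rightarrow> real) \<Rightarrow> real \<Rightarrow> (nat \<Rightarrow> 'a \<Rightarrow> real) \<Rightarrow> (nat \<Rightarrow> 'a) \<Rightarrow> bool" where
  "prox_bundle_stops f tol m z \<longleftrightarrow> (\<exists>j. model_error f m z j \<le> tol)"

text \<open>The next two are meaningful only for calls that stop. The iteration index starts at 0,
  so stopping at index \<open>j\<close> means \<open>j + 1\<close> inner iterations and output \<open>z (j + 1)\<close>.\<close>

definition inner_iterations ::
  "('a \<Rightarrow> real) \<Rightarrow> real \<Rightarrow> (nat \<Rightarrow> 'a \<Rightarrow> real) \<Rightarrow> (nat \<Rightarrow> 'a) \<Rightarrow> nat" where
  "inner_iterations f tol m z = Suc (LEAST j. model_error f m z j \<le> tol)"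

definition prox_bundle_output ::
  "('a \<Rightarrow> real) \<Rightarrow> real \<Rightarrow> (nat \<Rightarrow> 'a \<Rightarrow> real) \<Rightarrow> (nat \<Rightarrow> 'a) \<Rightarrow> 'a" where
  "prox_bundle_output f tol m z = z (inner_iterations f tol m z)"

text \<open>\<open>m k\<close> and \<open>z k\<close> are the models and points of the \<open>k\<close>-th call. The outer iterate
  \<open>y k\<close> is generated iff all earlier calls stop; only then is the \<open>k\<close>-th call made. That
  the calls stop is not part of the definition of a run.\<close>

definition outer_generated ::
  "('a \<Rightarrow> real) \<Rightarrow> (nat \<Rightarrow> real) \<Rightarrow> (nat \<Rightarrow> nat \<Rightarrow> 'a \<Rightarrow> real) \<Rightarrow> (nat \<Rightarrow> nat \<Rightarrow> 'a) \<Rightarrow>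
   nat \<Rightarrow> bool" where
  "outer_generated f tol m z k \<longleftrightarrow> (\<forall>i<k. prox_bundle_stops f (tol i) (m i) (z i))"

definition pbm_run ::
  "('a::real_inner \<Rightarrow> real) \<Rightarrow> ('a \<Rightarrow> ereal) \<Rightarrow> real \<Rightarrow> 'a \<Rightarrow> (nat \<Rightarrow> real) \<Rightarrow>
   (nat \<Rightarrow> 'a) \<Rightarrow> (nat \<Rightarrow> nat \<Rightarrow> 'a \<Rightarrow> real) \<Rightarrow> (nat \<Rightarrow> nat \<Rightarrow> 'a) \<Rightarrow> bool" where
  "pbm_run f h \<rho> y0 tol y m z \<longleftrightarrow>
     y 0 = y0 \<and>
     (\<forall>k. outer_generated f tol m z k \<longrightarrow>
        prox_bundle_run f h \<rho> (y k) (tol k) (m k) (z k) \<and>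
        (prox_bundle_stops f (tol k) (m k) (z k) \<longrightarrow>
           y (Suc k) = prox_bundle_output f (tol k) (m k) (z k)))"

definition total_inner_iterations ::
  "('a \<Rightarrow> real) \<Rightarrow> (nat \<Rightarrow> real) \<Rightarrow> (nat \<Rightarrow> nat \<Rightarrow> 'a \<Rightarrow> real) \<Rightarrow> (nat \<Rightarrow> nat \<Rightarrow> 'a) \<Rightarrow>
   nat \<Rightarrow> nat" where
  "total_inner_iterations f tol m z k = (\<Sum>i<k. inner_iterations f (tol i) (m i) (z i))"

end

theory Submission
  imports Defs
begin

text \<open>Within one call of the inner procedure the proximal model values
  \<open>v\<^sub>j = min (F\<^sub>j + \<rho>/2 \<parallel>\<cdot> - c\<parallel>\<^sup>2)\<close> increase by at least \<open>\<rho>/2 s\<^sub>j\<^sup>2\<close>, where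
  \<open>s\<^sub>j = \<parallel>z\<^sub>j\<^sub>+\<^sub>1 - z\<^sub>j\<parallel>\<close>, while \<open>e\<^sub>j \<le> L/(1+\<nu>) s\<^sub>j\<^bsup>1+\<nu>\<^esup>\<close> dominates the remaining gap
  \<open>\<delta>\<^sub>j = v\<^sub>n - v\<^sub>j\<close> to the last failing step \<open>n\<close>. For \<open>\<nu> = 1\<close> this makes \<open>\<delta>\<^sub>j\<close> decay
  geometrically. For \<open>\<nu> < 1\<close> it gives \<open>\<delta>\<^sub>j\<^sub>-\<^sub>1 \<ge> \<delta>\<^sub>j + A max(\<delta>\<^sub>j, \<epsilon>/2)\<^bsup>2/(1+\<nu>)\<^esup>\<close>, and a
  suitable potential drops by 1 per step. Both bounds depend on the centre \<open>y\<^sub>k\<close> only through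
  \<open>ln (1 + 2 (F(y\<^sub>k) - F\<^sup>\<star>)/\<epsilon>)\<close>. The outer steps satisfy
  \<open>2 (F(y\<^sub>k\<^sub>+\<^sub>1) - F\<^sup>\<star>) - \<epsilon> \<le> \<rho> (\<parallel>x - y\<^sub>k\<parallel>\<^sup>2 - \<parallel>x - y\<^sub>k\<^sub>+\<^sub>1\<parallel>\<^sup>2)\<close> for \<open>x \<in> X\<^sup>\<star>\<close>; summing bounds both
  the number of outer steps and, by concavity of the logarithm, the total of these terms.\<close>


section \<open>Subgradients and the Hoelder upper bound\<close>

text \<open>A hyperplane separates \<open>(x, f x)\<close> from the strict epigraph. It cannot be
  vertical because \<open>f\<close> is finite everywhere, so rescaling it gives an affine minorant
  that is exact at \<open>x\<close>.\<close>

lemma convex_on_ex_subgradient: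
  fixes f :: "'a::euclidean_space \<Rightarrow> real"
  assumes "convex_on UNIV f"
  shows "\<exists>g. \<forall>y. f y \<ge> f x + g \<bullet> (y - x)"
proof -
  let ?T = "{p :: 'a \<times> real. f (fst p) < snd p}"
  have "convex ?T"
  proof (rule convexI, clarsimp)
    fix p1 p2 :: 'a and r1 r2 u v :: real
    assume a: "f p1 < r1" "f p2 < r2" "0 \<le> u" "0 \<le> v" "u + v = 1"
    have "f (u *\<^sub>R p1 + v *\<^sub>R p2) \<le> u * f p1 + v * f p2"
      using assms a unfolding convex_on_def by auto
    also have "\<dots> < u * r1 + v * r2"
    proof (cases "u = 0")
      case False
      then have "u * f p1 < u * r1" using a by simp
      moreover have "v * f p2 \<le> v * r2" using a by (simp add: mult_left_mono)
      ultimately show ?thesis by linarith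
    qed (use a in auto)
    finally show "f (u *\<^sub>R p1 + v *\<^sub>R p2) < u * r1 + v * r2" .
  qed
  moreover have "?T \<noteq> {}"
    by (auto intro!: exI[of _ x] exI[of _ "f x + 1"])
  moreover have "{(x, f x)} \<inter> ?T = {}" by auto
  ultimately obtain a b where ab: "a \<noteq> 0" "a \<bullet> (x, f x) \<le> b" "\<And>p. p \<in> ?T \<Longrightarrow> b \<le> a \<bullet> p"
    using separating_hyperplane_sets[of "{(x, f x)}" ?T] by auto
  obtain a1 a2 where a: "a = (a1, a2)" by (cases a)
  have sep: "a1 \<bullet> x + a2 * f x \<le> a1 \<bullet> u + a2 * r" if "f u < r" for u r
    using ab(2) ab(3)[of "(u, r)"] that by (simp add: a)
  have a2: "a2 \<ge> 0"
    using sep[of x "f x + 1"] by (simp add: algebra_simps)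
  have "a2 \<noteq> 0"
  proof
    assume "a2 = 0"
    \<comment> \<open>A vertical hyperplane would bound \<open>a1 \<bullet> u\<close> from below
      over all \<open>u\<close>; moving from \<open>x\<close> in direction \<open>- a1\<close>
      refutes this.\<close>
    then have "a1 \<bullet> x \<le> a1 \<bullet> (x - a1)"
      using sep[of "x - a1" "f (x - a1) + 1"] by simp
    then have "a1 \<bullet> a1 \<le> 0" by (simp add: inner_diff_right)
    then have "a1 = 0" by (metis inner_eq_zero_iff inner_ge_zero order_antisym)
    with \<open>a2 = 0\<close> ab(1) a show False by (simp add: zero_prod_def)
  qed
  with a2 have a2: "a2 > 0" by simp
  have "f x + (- (1 / a2) *\<^sub>R a1) \<bullet> (y - x) \<le> f y" for y
  proof (rule field_le_epsilon)
    fix e :: real assume "e > 0"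
    then have "a1 \<bullet> x + a2 * f x \<le> a1 \<bullet> y + a2 * (f y + e)"
      by (intro sep) simp
    then show "f x + (- (1 / a2) *\<^sub>R a1) \<bullet> (y - x) \<le> f y + e"
      using a2 by (simp add: field_simps inner_diff_right)
  qed
  then show ?thesis by blast
qed

lemma mem_subdifferential_real:
  "g \<in> subdifferential_real f x \<longleftrightarrow> (\<forall>y. f x + g \<bullet> (y - x) \<le> f y)"
  by (simp add: subdifferential_def effective_domain_def)

text \<open>Without differentiability there is no gradient to integrate along the segment; a Riemann
  sum of subgradients takes the place of the integral. For \<open>\<nu> = 0\<close> the subgradient
  at \<open>y\<close> and Cauchy-Schwarz suffice.\<close>

lemma holder_smooth_upper_bound:
  fixes f :: "'a::euclidean_space \<Rightarrow> real"
  assumes convex: "convex_on UNIV f" and holder: "holder_smooth \<nu> L f"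
    and "0 \<le> \<nu>" "0 \<le> L" and g: "g \<in> subdifferential_real f x"
  shows "f y \<le> f x + g \<bullet> (y - x) + L / (1 + \<nu>) * norm (y - x) powr (1 + \<nu>)"
proof -
  define d where "d = y - x"
  have "\<exists>gs. \<forall>u. gs u \<in> subdifferential_real f u"
    using convex_on_ex_subgradient[OF convex] unfolding mem_subdifferential_real
    by (intro choice) auto
  then obtain gs where gs: "\<And>u. gs u \<in> subdifferential_real f u" by blast
  show ?thesis
  proof (cases "\<nu> = 0")
    case True
    have "f y - f x \<le> gs y \<bullet> (y - x)"
      using gs[of y, unfolded mem_subdifferential_real, rule_format, of x]
      by (simp add: inner_diff_right algebra_simps)
    also have "\<dots> = g \<bullet> (y - x) + (gs y - g) \<bullet> (y - x)"
      by (simp add: inner_diff_left)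
    also have "(gs y - g) \<bullet> (y - x) \<le> norm (gs y - g) * norm (y - x)"
      by (rule norm_cauchy_schwarz)
    also have "\<dots> \<le> L * norm (y - x)"
      using holder gs[of y] g True by (intro mult_right_mono) (auto simp: holder_smooth_def)
    finally show ?thesis using True by simp
  next
    case False
    with \<open>0 \<le> \<nu>\<close> have "\<nu> > 0" by simp
    define M where "M = L * norm d powr (1 + \<nu>)"
    have "M \<ge> 0" using \<open>0 \<le> L\<close> by (simp add: M_def)
    \<comment> \<open>The excess over the claimed bound along the segment, up to the constant
      \<open>f x\<close>; the claim is \<open>\<phi> 1 \<le> \<phi> 0\<close>.\<close>
    define \<phi> where "\<phi> t = f (x + t *\<^sub>R d) - t * (g \<bullet> d) - M / (1 + \<nu>) * t powr (1 + \<nu>)" for t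
    have step: "\<phi> t - \<phi> s \<le> M * (t - s) * (t powr \<nu> - s powr \<nu>)" if st: "0 \<le> s" "s < t" for s t
    proof -
      let ?g = "gs (x + t *\<^sub>R d)"
      have "f (x + t *\<^sub>R d) - f (x + s *\<^sub>R d) \<le> (t - s) * (?g \<bullet> d)"
        using gs[of "x + t *\<^sub>R d", unfolded mem_subdifferential_real, rule_format, of "x + s *\<^sub>R d"]
        by (simp add: inner_diff_right inner_add_right algebra_simps)
      also have "?g \<bullet> d \<le> g \<bullet> d + M * t powr \<nu>"
      proof -
        have "(?g - g) \<bullet> d \<le> norm (?g - g) * norm d"
          by (rule norm_cauchy_schwarz)
        also have "\<dots> \<le> L * norm (t *\<^sub>R d) powr \<nu> * norm d"
          using holder[unfolded holder_smooth_def, rule_format, OF gs[of "x + t *\<^sub>R d"] g] False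
          by (intro mult_right_mono) simp_all
        also have "\<dots> = M * t powr \<nu>"
          using st by (simp add: M_def powr_mult powr_add)
        finally show ?thesis by (simp add: inner_diff_left)
      qed
      finally have f_le: "f (x + t *\<^sub>R d) - f (x + s *\<^sub>R d) \<le> (t - s) * (g \<bullet> d + M * t powr \<nu>)"
        using st by simp
      have "(1 + \<nu>) * s powr \<nu> * (t - s) \<le> t powr (1 + \<nu>) - s powr (1 + \<nu>)"
      proof -
        have cont: "continuous_on {s..t} (\<lambda>u. u powr (1 + \<nu>))"
          using st \<open>\<nu> > 0\<close> by (intro continuous_intros continuous_on_powr') auto
        have der: "((\<lambda>u. u powr (1 + \<nu>)) has_real_derivative (1 + \<nu>) * u powr \<nu>) (at u)"
          if "s < u" "u < t" for u
          using st that by (auto intro!: derivative_eq_intros)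
        obtain u where u: "s < u" "u < t"
          "t powr (1 + \<nu>) - s powr (1 + \<nu>) = (t - s) * ((1 + \<nu>) * u powr \<nu>)"
          using MVT[OF st(2) cont] der by (metis DERIV_unique real_differentiable_def)
        have "s powr \<nu> \<le> u powr \<nu>" using u st \<open>\<nu> > 0\<close> by (intro powr_mono2) auto
        then have "(t - s) * (1 + \<nu>) * s powr \<nu> \<le> (t - s) * (1 + \<nu>) * u powr \<nu>"
          using st \<open>\<nu> > 0\<close> by (intro mult_left_mono) auto
        with u(3) show ?thesis by (simp add: mult_ac)
      qed
      then have "s powr \<nu> * (t - s) \<le> (t powr (1 + \<nu>) - s powr (1 + \<nu>)) / (1 + \<nu>)"
        using \<open>\<nu> > 0\<close> by (simp add: field_simps)
      then have "M * (s powr \<nu> * (t - s)) \<le> M * ((t powr (1 + \<nu>) - s powr (1 + \<nu>)) / (1 + \<nu>))"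
        using \<open>M \<ge> 0\<close> by (rule mult_left_mono)
      with f_le show ?thesis
        by (simp add: \<phi>_def algebra_simps diff_divide_distrib)
    qed
    \<comment> \<open>On the uniform partition the right-hand sides of \<open>step\<close> telescope as well.\<close>
    have sum_step: "\<phi> 1 - \<phi> 0 \<le> M / N" if "N > 0" for N :: nat
    proof -
      let ?t = "\<lambda>i. real i / N"
      have "\<phi> 1 - \<phi> 0 = (\<Sum>i<N. \<phi> (?t (Suc i)) - \<phi> (?t i))"
        using that by (subst sum_lessThan_telescope) simp
      also have "\<dots> \<le> (\<Sum>i<N. M / N * (?t (Suc i) powr \<nu> - ?t i powr \<nu>))"
      proof (rule sum_mono)
        fix i
        have "?t i < ?t (Suc i)" using that by (simp add: divide_strict_right_mono)
        moreover have "?t (Suc i) - ?t i = 1 / N" by (simp add: add_divide_distrib)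
        ultimately show "\<phi> (?t (Suc i)) - \<phi> (?t i) \<le> M / N * (?t (Suc i) powr \<nu> - ?t i powr \<nu>)"
          using step[of "?t i" "?t (Suc i)"] by simp
      qed
      also have "\<dots> = M / N"
        using that \<open>\<nu> > 0\<close> by (subst sum_distrib_left[symmetric], subst sum_lessThan_telescope) simp
      finally show ?thesis .
    qed
    have "(\<lambda>N. M / real N) \<longlonglongrightarrow> 0"
      by (rule lim_const_over_n)
    then have "\<phi> 1 - \<phi> 0 \<le> 0"
      by (rule LIMSEQ_le_const) (use sum_step in \<open>auto intro!: exI[of _ 1]\<close>)
    then show ?thesis
      using \<open>\<nu> > 0\<close> by (simp add: \<phi>_def M_def d_def)
  qed
qed

section \<open>Scalar inequalities and recursions\<close>

text \<open>Turns a bound on the sum of the scaled gaps into one on the sum of the logarithms in the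
  per-call counts. There \<open>K\<close> is the number of outer steps and \<open>N\<close> the
  ceiling that bounds it.\<close>

lemma sum_ln_add_one_le:
  fixes a :: "nat \<Rightarrow> real"
  assumes "\<And>k. k < K \<Longrightarrow> 0 \<le> a k" and "real K \<le> N" and "1 \<le> A"
    and "(\<Sum>k<K. a k) \<le> N * (A - 1)"
  shows "(\<Sum>k<K. ln (1 + a k)) \<le> N * ln A"
proof -
  have A: "A > 0" using assms(3) by simp
  \<comment> \<open>The tangent to \<open>ln\<close> at \<open>A\<close> replaces Jensen's inequality, which would give \<open>K\<close> in place
    of \<open>N\<close> and a different argument of the logarithm.\<close>
  have "(\<Sum>k<K. ln (1 + a k)) \<le> (\<Sum>k<K. ln A + ((1 + a k) / A - 1))"
  proof (rule sum_mono)
    fix k assume "k \<in> {..<K}"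
    then have "0 \<le> a k" using assms by simp
    then have "ln ((1 + a k) / A) \<le> (1 + a k) / A - 1"
      using A by (intro ln_le_minus_one) auto
    then show "ln (1 + a k) \<le> ln A + ((1 + a k) / A - 1)"
      using A \<open>0 \<le> a k\<close> by (simp add: ln_div)
  qed
  also have "\<dots> = K * ln A + ((K + (\<Sum>k<K. a k)) / A - K)"
    by (simp add: sum.distrib sum_subtractf sum_divide_distrib[symmetric] add_divide_distrib)
  also have "\<dots> \<le> K * ln A + ((K + N * (A - 1)) / A - K)"
    using assms(4) A by (simp add: divide_right_mono)
  also have "\<dots> = K * ln A + (N - K) * (1 - 1 / A)"
    using A by (simp add: field_simps)
  \<comment> \<open>The inequality \<open>1 - 1 / A \<le> ln A\<close> is
    \<open>ln x \<le> x - 1\<close> at \<open>x = 1 / A\<close>.\<close>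
  also have "\<dots> \<le> K * ln A + (N - K) * ln A"
    using ln_add_one_self_le_self2[of "1 / A - 1"] A assms(2)
    by (intro add_left_mono mult_left_mono) (auto simp: ln_div)
  finally show ?thesis by (simp add: algebra_simps)
qed

text \<open>Chaining \<open>le_error\<close> with \<open>decrease\<close> contracts the gap by
  \<open>1 + 1 / \<kappa>\<close> per step. Of the two factors \<open>1 + \<kappa>\<close> behind
  \<open>2 * ln (1 + \<kappa>)\<close>, one is the initial bound and the other enlarges the factor
  \<open>\<kappa>\<close> lost at the last step.\<close>

lemma geometric_gap_iterations:
  fixes \<delta> e :: "nat \<Rightarrow> real" and n :: nat
  assumes "\<kappa> > 0" "\<eta> > 0" "0 \<le> P"
    and nonneg: "\<And>j. j \<le> n \<Longrightarrow> 0 \<le> \<delta> j"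
    and le_error: "\<And>j. j \<le> n \<Longrightarrow> \<delta> j \<le> e j"
    and decrease: "\<And>j. j < n \<Longrightarrow> e (Suc j) \<le> \<kappa> * (\<delta> j - \<delta> (Suc j))"
    and initial: "\<delta> 0 \<le> (1 + \<kappa>) * P" and last: "\<eta> < e n"
  shows "n \<le> 1 + (2 * ln (1 + \<kappa>) + ln (1 + P / \<eta>)) / ln (1 + 1 / \<kappa>)"
proof (cases n)
  case 0
  with assms show ?thesis by (simp add: ln_ge_zero)
next
  case (Suc n')
  define r where "r = 1 + 1 / \<kappa>"
  have r: "r > 1" using \<open>\<kappa> > 0\<close> by (simp add: r_def)
  have geo: "j < n \<Longrightarrow> r ^ j * \<delta> j \<le> \<delta> 0" for j
  proof (induction j)
    case (Suc j)
    have "\<delta> (Suc j) \<le> \<kappa> * (\<delta> j - \<delta> (Suc j))"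
      using le_error[of "Suc j"] decrease[of j] Suc.prems by simp
    then have "r * \<delta> (Suc j) \<le> \<delta> j"
      using \<open>\<kappa> > 0\<close> by (simp add: r_def field_simps)
    then have "r ^ j * (r * \<delta> (Suc j)) \<le> r ^ j * \<delta> j"
      using r by (intro mult_left_mono) auto
    with Suc show ?case by (simp add: mult_ac)
  qed simp
  \<comment> \<open>The failed test concerns \<open>e n\<close>, and \<open>\<delta> n\<close> may
    vanish. Passing from \<open>e n\<close> to \<open>\<delta> n'\<close> costs one index, hence the
    \<open>1 +\<close> in the bound.\<close>
  have "\<eta> < e n" by (rule last)
  also have "e n \<le> \<kappa> * (\<delta> n' - \<delta> n)" using decrease[of n'] Suc by simp
  also have "\<dots> \<le> \<kappa> * \<delta> n'" using nonneg[of n] \<open>\<kappa> > 0\<close> by simp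
  finally have "r ^ n' * \<eta> < r ^ n' * (\<kappa> * \<delta> n')"
    using r by (intro mult_strict_left_mono) auto
  also have "\<dots> = \<kappa> * (r ^ n' * \<delta> n')" by simp
  also have "\<dots> \<le> \<kappa> * ((1 + \<kappa>) * P)"
    using geo[of n'] initial Suc \<open>\<kappa> > 0\<close> by (intro mult_left_mono) auto
  also have "\<dots> \<le> (1 + \<kappa>) * ((1 + \<kappa>) * P)"
    using \<open>\<kappa> > 0\<close> \<open>0 \<le> P\<close> by (intro mult_right_mono) auto
  also have "\<dots> \<le> (1 + \<kappa>)\<^sup>2 * (1 + P / \<eta>) * \<eta>"
  proof -
    have "P \<le> (1 + P / \<eta>) * \<eta>" using \<open>\<eta> > 0\<close> by (simp add: field_simps)
    then have "(1 + \<kappa>)\<^sup>2 * P \<le> (1 + \<kappa>)\<^sup>2 * ((1 + P / \<eta>) * \<eta>)"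
      by (intro mult_left_mono) auto
    then show ?thesis by (simp add: power2_eq_square mult_ac)
  qed
  finally have "r ^ n' \<le> (1 + \<kappa>)\<^sup>2 * (1 + P / \<eta>)"
    using \<open>\<eta> > 0\<close> by simp
  then have "ln (r ^ n') \<le> ln ((1 + \<kappa>)\<^sup>2 * (1 + P / \<eta>))"
    using r by (subst ln_le_cancel_iff) (use assms in \<open>auto intro!: mult_pos_pos add_pos_nonneg\<close>)
  also have "\<dots> = 2 * ln (1 + \<kappa>) + ln (1 + P / \<eta>)"
  proof -
    have "1 + P / \<eta> > 0" using assms by (intro add_pos_nonneg) auto
    then show ?thesis using \<open>\<kappa> > 0\<close> by (simp add: ln_mult ln_realpow)
  qed
  finally have "n' * ln r \<le> 2 * ln (1 + \<kappa>) + ln (1 + P / \<eta>)"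
    using r by (simp add: ln_realpow)
  moreover have "ln r > 0" using r by simp
  ultimately show ?thesis
    using Suc by (simp add: r_def[symmetric] field_simps)
qed

text \<open>Weighted AM-GM for \<open>1 / (1 + u)\<close> and 1 with weights \<open>a\<close> and
  \<open>1 - a\<close>.\<close>

lemma one_minus_powr_ge:
  fixes a u :: real
  assumes "0 \<le> a" "a \<le> 1" "0 \<le> u"
  shows "a * (u / (1 + u)) \<le> 1 - (1 + u) powr - a"
proof -
  have "(1 / (1 + u)) powr a * 1 powr (1 - a) \<le> a * (1 / (1 + u)) + (1 - a) * 1"
    using assms by (intro Youngs_inequality_0) auto
  moreover have "(1 / (1 + u)) powr a = (1 + u) powr - a"
    using assms by (simp add: powr_minus_divide powr_divide)
  ultimately show ?thesis using assms by (simp add: field_simps)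
qed

text \<open>A discrete form of \<open>x' = - A * max x \<eta> powr (1 + a)\<close>. The flow needs
  time at most \<open>1 / (a * A * \<eta> powr a)\<close> to come down to \<open>\<eta>\<close> from
  any height, and then \<open>1 / (A * \<eta> powr a)\<close> to reach 0. The logarithm and the
  factor 2 pay for discrete steps, which may more than halve \<open>x\<close>.\<close>

lemma superlinear_decrease_steps:
  fixes x :: "nat \<Rightarrow> real" and n :: nat
  assumes A: "A > 0" and a: "0 < a" "a \<le> 1" and \<eta>: "\<eta> > 0"
    and nonneg: "\<And>j. j \<le> n \<Longrightarrow> 0 \<le> x j"
    and step: "\<And>j. j < n \<Longrightarrow> x (Suc j) + A * max (x (Suc j)) \<eta> powr (1 + a) \<le> x j"
  shows "n \<le> 1 + ln (max (x 0 / \<eta>) 1) / ln 2 + (2 / a + 1) * (1 / (A * \<eta> powr a))"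
proof -
  \<comment> \<open>Above \<open>\<eta>\<close> the logarithm drops by 1 when \<open>A t\<^bsup>a\<^esup> \<ge> 1\<close> and the power term when \<open>A t\<^bsup>a\<^esup> < 1\<close>;
    the jump of height 1 at \<open>\<eta>\<close> pays for the one step that crosses it.\<close>
  define W where "W t = (if \<eta> \<le> t
    then ln (t / \<eta>) / ln 2 + 2 / (a * A) * (\<eta> powr - a - t powr - a) + 1 + 1 / (A * \<eta> powr a)
    else t / (A * \<eta> powr (1 + a)))" for t
  have W_le: "W t \<le> 1 / (A * \<eta> powr a)" if "t \<le> \<eta>" "\<not> \<eta> \<le> t" for t
    using that A \<eta> by (simp add: W_def powr_add field_simps)
  have W_ge: "W t \<ge> 1 + 1 / (A * \<eta> powr a)" if "\<eta> \<le> t" for t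
  proof -
    have "t powr - a \<le> \<eta> powr - a"
      using that \<eta> a by (intro powr_mono2') auto
    then have "0 \<le> 2 / (a * A) * (\<eta> powr - a - t powr - a)" using a A by simp
    moreover have "0 \<le> ln (t / \<eta>) / ln 2" using that \<eta> by simp
    ultimately show ?thesis using that by (simp add: W_def)
  qed
  have drop: "W s + 1 \<le> W t" if "0 \<le> s" and st: "s + A * max s \<eta> powr (1 + a) \<le> t" for s t
  proof (cases "\<eta> \<le> s")
    case True
    then have s: "s > 0" using \<eta> by simp
    define u where "u = A * s powr a"
    have u: "u > 0" using A s by (simp add: u_def)
    have "s * (1 + u) = s + A * max s \<eta> powr (1 + a)"
      using True s by (simp add: u_def powr_add max_def algebra_simps)
    with st have tu: "s * (1 + u) \<le> t" by simp
    moreover have "s \<le> s * (1 + u)" using s u by simp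
    ultimately have "\<eta> \<le> t" "s \<le> t" using True by linarith+
    have "1 \<le> (ln (t / \<eta>) - ln (s / \<eta>)) / ln 2 + 2 / (a * A) * (s powr - a - t powr - a)"
    proof (cases "u \<ge> 1")
      case True
      have "s * 2 \<le> s * (1 + u)" using s True by (intro mult_left_mono) auto
      with tu have "s * 2 \<le> t" by linarith
      then have "ln (s * 2) \<le> ln t" using s \<open>s \<le> t\<close> by (subst ln_le_cancel_iff) auto
      then have "1 \<le> (ln (t / \<eta>) - ln (s / \<eta>)) / ln 2"
        using s \<eta> \<open>s \<le> t\<close> by (simp add: ln_mult ln_div)
      moreover have "t powr - a \<le> s powr - a" using s a \<open>s \<le> t\<close> by (intro powr_mono2') auto
      then have "0 \<le> 2 / (a * A) * (s powr - a - t powr - a)" using a A by simp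
      ultimately show ?thesis by linarith
    next
      case False
      have "t powr - a \<le> (s * (1 + u)) powr - a" using s u a tu by (intro powr_mono2') auto
      also have "\<dots> = s powr - a * (1 + u) powr - a" using s u by (simp add: powr_mult)
      finally have "s powr - a * (1 - (1 + u) powr - a) \<le> s powr - a - t powr - a"
        by (simp add: algebra_simps)
      moreover have "s powr - a * (a * (u / (1 + u))) \<le> s powr - a * (1 - (1 + u) powr - a)"
        using a u by (intro mult_left_mono one_minus_powr_ge) auto
      moreover have "s powr - a * (a * (u / (1 + u))) = a * A / (1 + u)"
        using s by (simp add: u_def powr_minus_divide)
      \<comment> \<open>Here \<open>1 + u < 2\<close>, which is the origin of the 2 in the
        coefficient \<open>2 / (a * A)\<close> of the potential.\<close>
      moreover have "a * A / 2 \<le> a * A / (1 + u)"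
        using False u a A by (intro divide_left_mono) auto
      ultimately have "a * A / 2 \<le> s powr - a - t powr - a" by linarith
      then have "2 / (a * A) * (a * A / 2) \<le> 2 / (a * A) * (s powr - a - t powr - a)"
        using a A by (intro mult_left_mono) auto
      then have "1 \<le> 2 / (a * A) * (s powr - a - t powr - a)" using a A by simp
      moreover have "ln (s / \<eta>) \<le> ln (t / \<eta>)"
        using s \<eta> \<open>s \<le> t\<close> by (subst ln_le_cancel_iff) (auto simp: divide_right_mono)
      then have "0 \<le> (ln (t / \<eta>) - ln (s / \<eta>)) / ln 2" by simp
      ultimately show ?thesis by linarith
    qed
    then show ?thesis
      using True \<open>\<eta> \<le> t\<close> by (simp add: W_def algebra_simps diff_divide_distrib)
  next
    case False
    show ?thesis
    proof (cases "\<eta> \<le> t")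
      case True
      with False W_le[of s] W_ge[of t] show ?thesis by simp
    next
      case t: False
      have "s + A * \<eta> powr (1 + a) \<le> t" using st False by (simp add: max_def)
      then have "(s + A * \<eta> powr (1 + a)) / (A * \<eta> powr (1 + a)) \<le> t / (A * \<eta> powr (1 + a))"
        using A \<eta> by (intro divide_right_mono) auto
      then show ?thesis using False t A \<eta> by (simp add: W_def add_divide_distrib)
    qed
  qed
  have "j \<le> n \<Longrightarrow> W (x j) + j \<le> W (x 0)" for j
  proof (induction j)
    case (Suc j)
    then have "W (x (Suc j)) + 1 \<le> W (x j)" by (intro drop nonneg step) auto
    with Suc show ?case by simp
  qed simp
  from this[of n] have "n \<le> W (x 0) - W (x n)" by simp
  also have "\<dots> \<le> W (x 0)"
    using nonneg[of n] W_ge[of "x n"] A \<eta> by (simp add: W_def)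
  also have "\<dots> \<le> 1 + ln (max (x 0 / \<eta>) 1) / ln 2 + (2 / a + 1) * (1 / (A * \<eta> powr a))"
  proof (cases "\<eta> \<le> x 0")
    case True
    then have "max (x 0 / \<eta>) 1 = x 0 / \<eta>" using \<eta> by simp
    moreover have "2 / (a * A) * (\<eta> powr - a - x 0 powr - a) \<le> 2 / (a * A) * \<eta> powr - a"
      using a A by (intro mult_left_mono) auto
    moreover have "2 / (a * A) * \<eta> powr - a = 2 / a * (1 / (A * \<eta> powr a))"
      by (simp add: powr_minus_divide)
    ultimately show ?thesis using True by (simp add: W_def algebra_simps add_divide_distrib)
  next
    case False
    have "0 \<le> ln (max (x 0 / \<eta>) 1) / ln 2" by simp
    moreover have "0 \<le> 2 / a * (1 / (A * \<eta> powr a))" using a A by simp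
    ultimately show ?thesis
      using W_le[of "x 0"] False unfolding distrib_right mult_1 by linarith
  qed
  finally show ?thesis .
qed

section \<open>Real values of an extended-valued convex function\<close>

locale proper_convex_fun =
  fixes h :: "'a::euclidean_space \<Rightarrow> ereal"
  assumes h_proper: "proper_fun h" and h_convex: "convex_ereal h"
begin

text \<open>Where \<open>h\<close> is infinite this is the default value 0, so it is meaningful only
  at points of the effective domain.\<close>

definition H :: "'a \<Rightarrow> real" where
  "H x = real_of_ereal (h x)"

lemma h_eq: "x \<in> effective_domain h \<Longrightarrow> h x = ereal (H x)"
  using h_proper by (cases "h x") (auto simp: H_def proper_fun_def effective_domain_def)

lemma h_outside: "x \<notin> effective_domain h \<Longrightarrow> h x = \<infinity>"
  by (simp add: effective_domain_def)

lemma H_convex: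
  assumes "x \<in> effective_domain h" "y \<in> effective_domain h" "0 \<le> t" "t \<le> 1"
  shows "(1 - t) *\<^sub>R x + t *\<^sub>R y \<in> effective_domain h" (is "?u \<in> _")
    and "H ((1 - t) *\<^sub>R x + t *\<^sub>R y) \<le> (1 - t) * H x + t * H y"
proof -
  have le: "h ?u \<le> ereal ((1 - t) * H x + t * H y)"
    using h_convex[unfolded convex_ereal_def, rule_format, of "1 - t" t x y] assms
    by (simp add: h_eq)
  then show "?u \<in> effective_domain h"
    by (auto simp: effective_domain_def intro: le_less_trans)
  with le show "H ?u \<le> (1 - t) * H x + t * H y"
    by (simp add: h_eq)
qed

end

section \<open>One call of the inner procedure\<close>

locale prox_bundle_call = proper_convex_fun h
  for h :: "'a::euclidean_space \<Rightarrow> ereal" +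
  fixes f :: "'a \<Rightarrow> real" and \<rho> \<nu> L :: real and c :: 'a and tol :: real
    and m :: "nat \<Rightarrow> 'a \<Rightarrow> real" and z :: "nat \<Rightarrow> 'a"
  assumes f_convex: "convex_on UNIV f" and f_smooth: "holder_smooth \<nu> L f"
    and nu: "0 \<le> \<nu>" "\<nu> \<le> 1" and L_pos: "L > 0" and rho_pos: "\<rho> > 0" and tol_pos: "tol > 0"
    and c_dom: "c \<in> effective_domain h"
    and run: "prox_bundle_run f h \<rho> c tol m z"
begin

text \<open>Marks the steps that are carried out; the run constrains \<open>m j\<close> and
  \<open>z (Suc j)\<close> only for these. Nothing is said about the test at \<open>j\<close>
  itself: that it fails too is \<open>active (Suc j)\<close>.\<close>

definition active :: "nat \<Rightarrow> bool" where
  "active j \<longleftrightarrow> (\<forall>i<j. tol < model_error f m z i)"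

definition v :: "nat \<Rightarrow> real" where
  "v j = m j (z (Suc j)) + H (z (Suc j)) + \<rho> / 2 * (norm (z (Suc j) - c))\<^sup>2"

definition s :: "nat \<Rightarrow> real" where
  "s j = norm (z (Suc j) - z j)"

lemma active_mono: "active j \<Longrightarrow> i \<le> j \<Longrightarrow> active i"
  by (simp add: active_def)

lemma z_0: "z 0 = c"
  using run by (simp add: prox_bundle_run_def)

lemma valid: "active j \<Longrightarrow> valid_model f h \<rho> c m z j"
  using run by (simp add: prox_bundle_run_def active_def not_le)

lemma model_le: "active j \<Longrightarrow> m j x \<le> f x"
  using valid[of j] by (simp add: valid_model_def)

lemma
  assumes "active j"
  shows z_dom: "z (Suc j) \<in> effective_domain h"
    and z_min: "x \<in> effective_domain h \<Longrightarrow> v j \<le> m j x + H x + \<rho> / 2 * (norm (x - c))\<^sup>2"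
proof -
  have min: "composite (m j) h (z (Suc j)) + ereal (\<rho> / 2 * (norm (z (Suc j) - c))\<^sup>2)
      \<le> composite (m j) h x + ereal (\<rho> / 2 * (norm (x - c))\<^sup>2)" for x
    using run assms by (simp add: prox_bundle_run_def active_def is_arg_min_def not_le not_less)
  \<comment> \<open>The centre already gives the subproblem a finite value, so its minimizer has one
    as well.\<close>
  show dom: "z (Suc j) \<in> effective_domain h"
  proof (rule ccontr)
    assume "z (Suc j) \<notin> effective_domain h"
    with min[of c] c_dom show False by (simp add: composite_def h_eq h_outside)
  qed
  show "v j \<le> m j x + H x + \<rho> / 2 * (norm (x - c))\<^sup>2" if "x \<in> effective_domain h"
    using min[of x] dom that by (simp add: composite_def h_eq v_def)
qed

lemma v_le: "active j \<Longrightarrow> x \<in> effective_domain h \<Longrightarrow> v j \<le> f x + H x + \<rho> / 2 * (norm (x - c))\<^sup>2"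
  using z_min[of j x] model_le[of j x] by simp

text \<open>Because \<open>a + b = \<rho> *\<^sub>R (c - ?p)\<close>, the aggregate cut plus the
  subgradient bound on \<open>h\<close> plus the proximal term is a paraboloid of curvature
  \<open>\<rho>\<close> with vertex at \<open>?p\<close> and minimum \<open>v j\<close>. It
  minorizes the next subproblem and is evaluated at \<open>?q\<close>.\<close>

lemma v_step:
  assumes "active (Suc j)"
  shows "v j + \<rho> / 2 * (s (Suc j))\<^sup>2 \<le> v (Suc j)"
proof -
  let ?p = "z (Suc j)" and ?q = "z (Suc (Suc j))"
  obtain a b where b: "b \<in> subdifferential h ?p" and ab: "a + b = \<rho> *\<^sub>R (c - ?p)"
    and a: "\<And>x. m j ?p + a \<bullet> (x - ?p) \<le> m (Suc j) x"
    using valid[OF assms] by (auto simp: valid_model_def)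
  have "?p \<in> effective_domain h" "?q \<in> effective_domain h"
    using assms by (auto intro!: z_dom active_mono[OF assms, of j])
  then have "H ?p + b \<bullet> (?q - ?p) \<le> H ?q"
    using b by (auto simp: subdifferential_def h_eq dest!: spec[of _ ?q])
  with a[of ?q] have "m j ?p + H ?p + (a + b) \<bullet> (?q - ?p) \<le> m (Suc j) ?q + H ?q"
    by (simp add: inner_add_left)
  moreover have "(a + b) \<bullet> (?q - ?p) + \<rho> / 2 * (norm (?q - c))\<^sup>2
      = \<rho> / 2 * (norm (?p - c))\<^sup>2 + \<rho> / 2 * (norm (?q - ?p))\<^sup>2"
    unfolding ab
    by (simp add: power2_norm_eq_inner inner_diff_left inner_diff_right inner_commute algebra_simps)
  ultimately show ?thesis by (simp add: v_def s_def)
qed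

lemma v_mono:
  assumes "active k" "i \<le> k" shows "v i \<le> v k"
  using assms(2,1)
proof (induction rule: dec_induct)
  case (step n)
  have "0 \<le> \<rho> / 2 * (s (Suc n))\<^sup>2" using rho_pos by simp
  moreover have "v i \<le> v n" using step active_mono[of "Suc n" n] by simp
  ultimately show ?case using v_step[of n] step.prems by linarith
qed simp

text \<open>The subgradients at \<open>z (Suc j)\<close> come with the next model, which is not
  built after the stopping step. Quadratic growth is therefore derived from convexity alone: compare
  with a point of the segment towards \<open>x\<close>, divide by \<open>t\<close> and let
  \<open>t\<close> tend to 0.\<close>

lemma prox_strong_minimality:
  assumes "active j" "x \<in> effective_domain h"
  shows "v j + \<rho> / 2 * (norm (x - z (Suc j)))\<^sup>2 \<le> m j x + H x + \<rho> / 2 * (norm (x - c))\<^sup>2"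
proof -
  let ?p = "z (Suc j)" and ?D = "m j x + H x + \<rho> / 2 * (norm (x - c))\<^sup>2"
  have le: "v j + \<rho> / 2 * (1 - t) * (norm (x - ?p))\<^sup>2 \<le> ?D" if t: "0 < t" "t \<le> 1" for t
  proof -
    let ?u = "(1 - t) *\<^sub>R ?p + t *\<^sub>R x"
    have dom: "?p \<in> effective_domain h" using z_dom assms by simp
    have "m j ?u \<le> (1 - t) * m j ?p + t * m j x"
      using valid[OF assms(1)] t by (auto simp: valid_model_def convex_on_def)
    moreover have "H ?u \<le> (1 - t) * H ?p + t * H x"
      using H_convex(2)[OF dom assms(2)] t by simp
    moreover have "v j \<le> m j ?u + H ?u + \<rho> / 2 * (norm (?u - c))\<^sup>2"
      using z_min[OF assms(1)] H_convex(1)[OF dom assms(2)] t by simp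
    \<comment> \<open>The last term, the exact convexity surplus of the squared norm, produces the
      growth term.\<close>
    moreover have "(norm (?u - c))\<^sup>2 = (1 - t) * (norm (?p - c))\<^sup>2
        + t * (norm (x - c))\<^sup>2 - t * (1 - t) * (norm (x - ?p))\<^sup>2"
      by (simp add: power2_norm_eq_inner inner_diff_left inner_diff_right inner_add_left
          inner_add_right inner_commute algebra_simps)
    then have "\<rho> / 2 * (norm (?u - c))\<^sup>2 = (1 - t) * (\<rho> / 2 * (norm (?p - c))\<^sup>2)
        + t * (\<rho> / 2 * (norm (x - c))\<^sup>2) - t * (\<rho> / 2 * (1 - t) * (norm (x - ?p))\<^sup>2)"
      by (simp only:) (simp add: field_simps)
    ultimately have "t * (v j + \<rho> / 2 * (1 - t) * (norm (x - ?p))\<^sup>2) \<le> t * ?D"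
      by (simp add: v_def algebra_simps diff_divide_distrib)
    with t show ?thesis by (simp add: mult_le_cancel_left)
  qed
  have "((\<lambda>t. v j + \<rho> / 2 * (1 - t) * (norm (x - ?p))\<^sup>2)
      \<longlongrightarrow> v j + \<rho> / 2 * (1 - 0) * (norm (x - ?p))\<^sup>2) (at_right 0)"
    by (intro tendsto_intros)
  moreover have "eventually (\<lambda>t. v j + \<rho> / 2 * (1 - t) * (norm (x - ?p))\<^sup>2 \<le> ?D) (at_right 0)"
    unfolding eventually_at_right_field using le by (auto intro!: exI[of _ 1])
  ultimately have "v j + \<rho> / 2 * (1 - 0) * (norm (x - ?p))\<^sup>2 \<le> ?D"
    by (rule tendsto_upperbound) simp
  then show ?thesis by simp
qed

text \<open>The model lies above the linearization of \<open>f\<close> at \<open>z j\<close>, so its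
  error is at most that of the linearization.\<close>

lemma linearization_error_le:
  assumes "active j"
  shows "f x - m j x \<le> L / (1 + \<nu>) * norm (x - z j) powr (1 + \<nu>)"
proof -
  obtain g where g: "g \<in> subdifferential_real f (z j)" and
    le: "\<And>x. f (z j) + g \<bullet> (x - z j) \<le> m j x"
    using valid[OF assms] by (auto simp: valid_model_def)
  show ?thesis
    using holder_smooth_upper_bound[OF f_convex f_smooth nu(1) _ g, of x] le[of x] L_pos by simp
qed

lemma model_error_le: "active j \<Longrightarrow> model_error f m z j \<le> L / (1 + \<nu>) * s j powr (1 + \<nu>)"
  using linearization_error_le[of j "z (Suc j)"] by (simp add: model_error_def s_def)

text \<open>Test the later subproblem at \<open>z (Suc j)\<close> and bound its model by
  \<open>f\<close>: the value obtained exceeds \<open>v j\<close> by exactly the model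
  error.\<close>

lemma gap_le_error:
  assumes "active k" "j \<le> k" shows "v k - v j \<le> model_error f m z j"
  using v_le[OF assms(1) z_dom[of j]] active_mono[OF assms] by (simp add: v_def model_error_def)

text \<open>The first model may lie far below \<open>f\<close>. Comparing \<open>Fmin\<close> with
  the objective at a point of the segment from \<open>c\<close> to \<open>z 1\<close> brings in the
  model error only at distance \<open>t * s 0\<close>. The choice of \<open>t\<close> balances
  \<open>1 / t\<close> against \<open>t powr \<nu>\<close>.\<close>

lemma initial_gap_le:
  assumes low: "\<And>x. x \<in> effective_domain h \<Longrightarrow> Fmin \<le> f x + H x" and t: "0 < t" "t \<le> 1"
  shows "f c + H c - v 0 \<le> (f c + H c - Fmin) / t
    + L / (1 + \<nu>) * t powr \<nu> * s 0 powr (1 + \<nu>) - \<rho> / 2 * (s 0)\<^sup>2"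
proof -
  let ?u = "(1 - t) *\<^sub>R c + t *\<^sub>R z 1"
  have a0: "active 0" by (simp add: active_def)
  have dom: "z 1 \<in> effective_domain h" using z_dom[OF a0] by simp
  have u_c: "?u - c = t *\<^sub>R (z 1 - z 0)" by (simp add: z_0 algebra_simps)
  have "Fmin \<le> f ?u + H ?u" using low H_convex(1)[OF c_dom dom] t by simp
  also have "f ?u \<le> m 0 ?u + L / (1 + \<nu>) * (t * s 0) powr (1 + \<nu>)"
    using linearization_error_le[OF a0, of ?u] t u_c by (simp add: z_0 s_def)
  also have "m 0 ?u \<le> (1 - t) * m 0 c + t * m 0 (z 1)"
    using valid[OF a0] t by (auto simp: valid_model_def convex_on_def)
  also have "(1 - t) * m 0 c \<le> (1 - t) * f c"
    using model_le[OF a0] t by (intro mult_left_mono) auto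
  also have "H ?u \<le> (1 - t) * H c + t * H (z 1)"
    using H_convex(2)[OF c_dom dom] t by simp
  also have "(t * s 0) powr (1 + \<nu>) = t * (t powr \<nu> * s 0 powr (1 + \<nu>))"
    using t by (simp add: s_def powr_mult powr_add)
  finally have "(f c + H c - m 0 (z 1) - H (z 1)) * t
      \<le> (f c + H c - Fmin) + t * (L / (1 + \<nu>) * t powr \<nu> * s 0 powr (1 + \<nu>))"
    by (simp add: algebra_simps)
  then have "f c + H c - m 0 (z 1) - H (z 1)
      \<le> (f c + H c - Fmin) / t + L / (1 + \<nu>) * t powr \<nu> * s 0 powr (1 + \<nu>)"
    using t by (simp add: pos_le_divide_eq[symmetric] add_divide_distrib)
  then show ?thesis by (simp add: v_def s_def z_0)
qed

end

section \<open>Iteration counts for one call\<close>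

context prox_bundle_call
begin

text \<open>The error bound \<open>L / 2 * (s j)\<^sup>2\<close> and the increase
  \<open>\<rho> / 2 * (s j)\<^sup>2\<close> of \<open>v\<close> have the same order, with ratio
  \<open>L / \<rho>\<close>; hence the geometric recursion.\<close>

lemma smooth_active_bound:
  assumes "\<nu> = 1" and low: "\<And>x. x \<in> effective_domain h \<Longrightarrow> Fmin \<le> f x + H x"
    and active: "active (Suc n)"
  shows "n \<le> 1 + (2 * ln (1 + L / \<rho>) + ln (1 + (f c + H c - Fmin) / tol)) / ln (1 + \<rho> / L)"
proof -
  let ?P = "f c + H c - Fmin" and ?\<kappa> = "L / \<rho>"
  have act: "active j" if "j \<le> n" for j using active_mono[OF active] that by simp
  have \<kappa>: "?\<kappa> > 0" using L_pos rho_pos by simp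
  have "n \<le> 1 + (2 * ln (1 + ?\<kappa>) + ln (1 + ?P / tol)) / ln (1 + 1 / ?\<kappa>)"
  proof (rule geometric_gap_iterations[where \<delta> = "\<lambda>j. v n - v j" and e = "model_error f m z"])
    show "?\<kappa> > 0" "tol > 0" by fact+ (rule tol_pos)
    show "0 \<le> ?P" using low[OF c_dom] by simp
    show "0 \<le> v n - v j" if "j \<le> n" for j using v_mono[OF act that] by simp
    show "v n - v j \<le> model_error f m z j" if "j \<le> n" for j by (rule gap_le_error[OF act that]) simp
    show "model_error f m z (Suc j) \<le> ?\<kappa> * ((v n - v j) - (v n - v (Suc j)))" if "j < n" for j
    proof -
      have "model_error f m z (Suc j) \<le> ?\<kappa> * (\<rho> / 2 * (s (Suc j))\<^sup>2)"
        using model_error_le[OF act, of "Suc j"] that \<open>\<nu> = 1\<close> rho_pos by (simp add: s_def)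
      also have "\<dots> \<le> ?\<kappa> * (v (Suc j) - v j)"
        using v_step[OF act, of j] that \<kappa> by (intro mult_left_mono) auto
      finally show ?thesis by simp
    qed
    show "v n - v 0 \<le> (1 + ?\<kappa>) * ?P"
    proof -
      have "v n \<le> f c + H c" using v_le[OF act c_dom, of n] by simp
      \<comment> \<open>With \<open>t = 1 / (1 + ?\<kappa>)\<close> one has
        \<open>L * t \<le> \<rho>\<close>, so the proximal term absorbs the error term.\<close>
      moreover have "f c + H c - v 0 \<le> ?P / (1 / (1 + ?\<kappa>))
          + L / (1 + \<nu>) * (1 / (1 + ?\<kappa>)) powr \<nu> * s 0 powr (1 + \<nu>) - \<rho> / 2 * (s 0)\<^sup>2"
        using \<kappa> by (intro initial_gap_le low) auto
      moreover have "?P / (1 / (1 + ?\<kappa>)) = (1 + ?\<kappa>) * ?P" by simp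
      moreover have "L / (1 + \<nu>) * (1 / (1 + ?\<kappa>)) powr \<nu> * s 0 powr (1 + \<nu>) \<le> \<rho> / 2 * (s 0)\<^sup>2"
      proof -
        have "L / (1 + ?\<kappa>) \<le> \<rho>" using L_pos rho_pos by (simp add: field_simps)
        then have "L / (1 + ?\<kappa>) / 2 * (s 0)\<^sup>2 \<le> \<rho> / 2 * (s 0)\<^sup>2"
          by (intro mult_right_mono divide_right_mono) auto
        moreover have "L / (1 + \<nu>) * (1 / (1 + ?\<kappa>)) powr \<nu> * s 0 powr (1 + \<nu>)
            = L / (1 + ?\<kappa>) / 2 * (s 0)\<^sup>2"
          using \<kappa> \<open>\<nu> = 1\<close> by (simp add: s_def)
        ultimately show ?thesis by simp
      qed
      ultimately show ?thesis by linarith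
    qed
    show "tol < model_error f m z n" using active by (simp add: active_def)
  qed
  then show ?thesis by simp
qed

text \<open>Maximizing the left side over \<open>s j\<close> gives the right side times
  \<open>(1 - \<nu>) / (1 + \<nu>) \<le> 1\<close>. Young's inequality with weight
  \<open>(1 + \<nu>) / 2\<close> is tight at the maximizer, where
  \<open>(s j)\<^sup>2 = ?K\<close>.\<close>

lemma holder_young:
  assumes "\<nu> < 1"
  shows "L / (1 + \<nu>) * s j powr (1 + \<nu>) - \<rho> / 2 * (s j)\<^sup>2 \<le> \<rho> / 2 * (L / \<rho>) powr (2 / (1 - \<nu>))"
proof (cases "s j = 0")
  case False
  then have s: "s j > 0" by (simp add: s_def)
  let ?K = "(L / \<rho>) powr (2 / (1 - \<nu>))" and ?\<theta> = "(1 + \<nu>) / 2"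
  have "(s j)\<^sup>2 powr ?\<theta> * ?K powr (1 - ?\<theta>) \<le> ?\<theta> * (s j)\<^sup>2 + (1 - ?\<theta>) * ?K"
    using nu s L_pos rho_pos by (intro Youngs_inequality_0) auto
  moreover have "(s j)\<^sup>2 powr ?\<theta> = s j powr (1 + \<nu>)"
    using s by (simp add: powr_powr add_divide_distrib flip: powr_numeral)
  moreover have "?K powr (1 - ?\<theta>) = L / \<rho>"
  proof -
    have \<theta>: "1 - ?\<theta> = (1 - \<nu>) / 2" by (simp add: field_simps)
    have one: "2 / (1 - \<nu>) * ((1 - \<nu>) / 2) = 1" using assms by simp
    show ?thesis unfolding \<theta> powr_powr one using L_pos rho_pos by simp
  qed
  ultimately have "s j powr (1 + \<nu>) * (L / \<rho>) * (\<rho> / (1 + \<nu>))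
      \<le> (?\<theta> * (s j)\<^sup>2 + (1 - ?\<theta>) * ?K) * (\<rho> / (1 + \<nu>))"
    using rho_pos nu by (intro mult_right_mono) auto
  moreover have "s j powr (1 + \<nu>) * (L / \<rho>) * (\<rho> / (1 + \<nu>)) = L / (1 + \<nu>) * s j powr (1 + \<nu>)"
    using rho_pos by simp
  moreover have "(?\<theta> * (s j)\<^sup>2 + (1 - ?\<theta>) * ?K) * (\<rho> / (1 + \<nu>))
      = \<rho> / 2 * (s j)\<^sup>2 + (1 - \<nu>) / (1 + \<nu>) * (\<rho> / 2 * ?K)"
    using nu by (simp add: field_simps)
  moreover have "(1 - \<nu>) / (1 + \<nu>) * (\<rho> / 2 * ?K) \<le> 1 * (\<rho> / 2 * ?K)"
    using nu rho_pos by (intro mult_right_mono) auto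
  ultimately show ?thesis by linarith
qed (use rho_pos in simp)

text \<open>The exponent satisfies \<open>(1 + \<nu>) * (1 + a) = 2\<close>, so the error bound
  raised to the power \<open>1 + a\<close> controls \<open>(s j)\<^sup>2\<close>, the increase of
  \<open>v\<close>. \<open>B\<close> is the quantity of the final estimate with
  \<open>\<epsilon> = 2 * tol\<close>.\<close>

lemma holder_active_bound:
  defines "a \<equiv> (1 - \<nu>) / (1 + \<nu>)"
  defines "B \<equiv> (2 / (1 + \<nu>)) powr a * (L powr (2 / (1 + \<nu>)) / (\<rho> * (2 * tol) powr a))"
  assumes "\<nu> < 1" and low: "\<And>x. x \<in> effective_domain h \<Longrightarrow> Fmin \<le> f x + H x"
    and active: "active (Suc n)"
  shows "n \<le> 1 + 4 * ln (1 + (f c + H c - Fmin) / tol) + 8 / (1 - \<nu>) * B"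
proof -
  let ?P = "f c + H c - Fmin"
  define A where "A = \<rho> / 2 * ((1 + \<nu>) / L) powr (1 + a)"
  have act: "active j" if "j \<le> n" for j using active_mono[OF active] that by simp
  have a: "0 < a" "a \<le> 1" using nu \<open>\<nu> < 1\<close> by (auto simp: a_def)
  have a1: "1 + a = 2 / (1 + \<nu>)" using nu by (simp add: a_def field_simps)
  have two: "(1 + \<nu>) * (1 + a) = 2" using nu by (simp add: a1 field_simps)
  have A: "A > 0" using L_pos rho_pos nu by (simp add: A_def)
  have B: "B > 0" using L_pos rho_pos nu tol_pos by (simp add: B_def)
  have P: "0 \<le> ?P" using low[OF c_dom] by simp
  have n_le: "n \<le> 1 + ln (max ((v n - v 0) / tol) 1) / ln 2 + (2 / a + 1) * (1 / (A * tol powr a))"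
  proof (rule superlinear_decrease_steps[where x = "\<lambda>j. v n - v j"])
    show "A > 0" "0 < a" "a \<le> 1" "tol > 0" by fact+ (rule tol_pos)
    show "0 \<le> v n - v j" if "j \<le> n" for j using v_mono[OF act that] by simp
    show "v n - v (Suc j) + A * max (v n - v (Suc j)) tol powr (1 + a) \<le> v n - v j" if "j < n" for j
    proof -
      let ?e = "max (v n - v (Suc j)) tol"
      \<comment> \<open>The error dominates both arguments of the maximum: the gap always, and
        \<open>tol\<close> because the test failed at this step.\<close>
      have "?e \<le> model_error f m z (Suc j)"
        using gap_le_error[OF act, of n "Suc j"] active that by (simp add: active_def less_imp_le)
      also have "\<dots> \<le> L / (1 + \<nu>) * s (Suc j) powr (1 + \<nu>)"
        using model_error_le[OF act] that by simp
      finally have "(1 + \<nu>) / L * ?e \<le> (1 + \<nu>) / L * (L / (1 + \<nu>) * s (Suc j) powr (1 + \<nu>))"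
        using nu L_pos by (intro mult_left_mono) auto
      also have "\<dots> = s (Suc j) powr (1 + \<nu>)" using nu L_pos by simp
      finally have "((1 + \<nu>) / L * ?e) powr (1 + a) \<le> (s (Suc j) powr (1 + \<nu>)) powr (1 + a)"
        using nu L_pos tol_pos a by (intro powr_mono2) (auto intro!: mult_nonneg_nonneg)
      also have "\<dots> = s (Suc j) powr ((1 + \<nu>) * (1 + a))" by (rule powr_powr)
      also note two
      also have "s (Suc j) powr 2 = (s (Suc j))\<^sup>2" by (simp add: s_def)
      finally have "((1 + \<nu>) / L) powr (1 + a) * ?e powr (1 + a) \<le> (s (Suc j))\<^sup>2"
        using nu L_pos tol_pos by (subst powr_mult[symmetric]) auto
      then have "\<rho> / 2 * (((1 + \<nu>) / L) powr (1 + a) * ?e powr (1 + a)) \<le> \<rho> / 2 * (s (Suc j))\<^sup>2"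
        using rho_pos by (intro mult_left_mono) auto
      then show ?thesis using v_step[OF act, of j] that by (simp add: A_def mult_ac)
    qed
  qed
  have A_B: "1 / (A * tol powr a) = 2 * B / (1 + \<nu>)"
  proof -
    have "(1 + \<nu>) powr a * (1 + a) powr a = 2 powr a"
      using nu a unfolding two[symmetric] by (simp add: powr_mult)
    then have "A * tol powr a * B = (1 + \<nu>) / 2"
      using nu L_pos rho_pos tol_pos
      by (simp add: A_def B_def powr_add powr_mult powr_divide flip: a1)
    then show ?thesis using A B tol_pos nu by (simp add: field_simps)
  qed
  \<comment> \<open>The initial excess over \<open>?P\<close> is thus a power of \<open>B\<close>
    times \<open>tol\<close>; inside the logarithm it costs only a multiple of
    \<open>ln (1 + B) \<le> B\<close>.\<close>
  have K_B: "\<rho> / 2 * (L / \<rho>) powr (2 / (1 - \<nu>)) \<le> tol * B powr (1 / a)"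
  proof -
    have "B powr (1 / a) = 2 / (1 + \<nu>) * ((L powr (1 + a)) powr (1 / a) / (\<rho> powr (1 / a) * (2 * tol)))"
      using a L_pos rho_pos tol_pos nu by (simp add: B_def powr_mult powr_divide powr_powr flip: a1)
    also have "(L powr (1 + a)) powr (1 / a) = L powr (2 / (1 - \<nu>))"
      using nu \<open>\<nu> < 1\<close> by (simp add: powr_powr a1) (simp add: a_def)
    also have "\<rho> powr (1 / a) = \<rho> powr (2 / (1 - \<nu>)) / \<rho>"
    proof -
      have "1 / a = 2 / (1 - \<nu>) - 1" using nu \<open>\<nu> < 1\<close> by (simp add: a_def field_simps)
      then show ?thesis using rho_pos by (simp add: powr_diff)
    qed
    finally have "tol * B powr (1 / a) = 2 / (1 + \<nu>) * (\<rho> / 2 * (L / \<rho>) powr (2 / (1 - \<nu>)))"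
      using L_pos rho_pos tol_pos by (simp add: powr_divide)
    moreover have "1 * (\<rho> / 2 * (L / \<rho>) powr (2 / (1 - \<nu>))) \<le> 2 / (1 + \<nu>) * (\<rho> / 2 * (L / \<rho>) powr (2 / (1 - \<nu>)))"
      using nu rho_pos by (intro mult_right_mono) auto
    ultimately show ?thesis by simp
  qed
  have "v n \<le> f c + H c" using v_le[OF act c_dom, of n] by simp
  \<comment> \<open>The choice \<open>t = 1\<close> is enough here, since
    \<open>holder_young\<close> bounds the remaining terms.\<close>
  moreover have "f c + H c - v 0 \<le> ?P / 1
      + L / (1 + \<nu>) * 1 powr \<nu> * s 0 powr (1 + \<nu>) - \<rho> / 2 * (s 0)\<^sup>2"
    by (intro initial_gap_le low) auto
  ultimately have "v n - v 0 \<le> (?P / tol + B powr (1 / a)) * tol"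
    using holder_young[OF \<open>\<nu> < 1\<close>, of 0] K_B
    tol_pos unfolding powr_one_eq_one mult_1_right div_by_1 distrib_right by (simp add: mult.commute)
  then have gap: "(v n - v 0) / tol \<le> ?P / tol + B powr (1 / a)"
    using tol_pos by (simp add: pos_divide_le_eq)
  have "max ((v n - v 0) / tol) 1 \<le> (1 + ?P / tol) * (1 + B) powr (1 / a)"
  proof -
    have "1 \<le> (1 + B) powr (1 / a)" "B powr (1 / a) \<le> (1 + B) powr (1 / a)"
      using a B by (auto intro!: powr_mono2 ge_one_powr_ge_zero)
    \<comment> \<open>Superadditivity of a power with exponent \<open>1 / a \<ge> 1\<close>.\<close>
    moreover have "1 + B powr (1 / a) \<le> (1 + B) powr (1 / a)"
    proof -
      have "1 / a = 1 + (1 / a - 1)" by simp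
      moreover have "1 \<le> (1 + B) powr (1 / a - 1)" "B powr (1 / a - 1) \<le> (1 + B) powr (1 / a - 1)"
        using a B by (auto intro!: powr_mono2 ge_one_powr_ge_zero)
      then have "1 + B * B powr (1 / a - 1) \<le> (1 + B) powr (1 / a - 1) + B * (1 + B) powr (1 / a - 1)"
        using B by (intro add_mono mult_left_mono) auto
      ultimately show ?thesis using B by (metis distrib_right mult_1 powr_add powr_one add_pos_pos less_imp_le zero_less_one)
    qed
    moreover have "?P / tol * 1 \<le> ?P / tol * (1 + B) powr (1 / a)"
      using P tol_pos \<open>1 \<le> (1 + B) powr (1 / a)\<close> by (intro mult_left_mono) auto
    moreover have "0 \<le> ?P / tol" using P tol_pos by simp
    ultimately show ?thesis using gap unfolding distrib_right by simp
  qed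
  then have "ln (max ((v n - v 0) / tol) 1) \<le> ln ((1 + ?P / tol) * (1 + B) powr (1 / a))"
    using P B tol_pos by (subst ln_le_cancel_iff) (auto intro!: mult_pos_pos add_pos_nonneg)
  also have "\<dots> = ln (1 + ?P / tol) + 1 / a * ln (1 + B)"
  proof -
    have "1 + ?P / tol > 0" using P tol_pos by (intro add_pos_nonneg) auto
    then show ?thesis using B by (simp add: ln_mult ln_powr)
  qed
  also have "\<dots> \<le> ln (1 + ?P / tol) + 1 / a * B"
    using a B by (intro add_left_mono mult_left_mono ln_add_one_self_le_self) auto
  finally have "ln (max ((v n - v 0) / tol) 1) / ln 2 \<le> (ln (1 + ?P / tol) + 1 / a * B) / ln 2"
    by (intro divide_right_mono) auto
  also have "\<dots> \<le> (ln (1 + ?P / tol) + 1 / a * B) / (2 / 3)"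
    using P tol_pos a B ln2_ge_two_thirds
    by (intro divide_left_mono) (auto intro!: add_nonneg_nonneg)
  also have "\<dots> = 3 / 2 * ln (1 + ?P / tol) + 3 / 2 * (1 / a) * B" by (simp add: field_simps)
  finally have "n \<le> 1 + 3 / 2 * ln (1 + ?P / tol)
      + (3 / 2 * (1 / a) * B + (2 / a + 1) * (2 * B / (1 + \<nu>)))"
    using n_le unfolding A_B by linarith
  also have "3 / 2 * (1 / a) * B + (2 / a + 1) * (2 * B / (1 + \<nu>))
      = (3 / 2 * (1 / a) + (2 / a + 1) * (2 / (1 + \<nu>))) * B"
    unfolding distrib_right[of "3 / 2 * (1 / a)"] by simp
  also have "(3 / 2 * (1 / a) + (2 / a + 1) * (2 / (1 + \<nu>))) * B \<le> 8 / (1 - \<nu>) * B"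
  \<comment> \<open>Over the common denominator \<open>1 - \<nu>\<close> the numerator is at most 8,
    because \<open>a \<le> 1 - \<nu>\<close>.\<close>
  proof (rule mult_right_mono)
    have "3 / 2 * (1 / (p / q)) + (2 / (p / q) + 1) * (2 / q) = (3 / 2 * q + 4 + 2 * (p / q)) / p"
      if "0 < p" "0 < q" for p q :: real
      using that by (simp add: field_simps)
    from this[of "1 - \<nu>" "1 + \<nu>"] have "3 / 2 * (1 / a) + (2 / a + 1) * (2 / (1 + \<nu>))
        = (3 / 2 * (1 + \<nu>) + 4 + 2 * a) / (1 - \<nu>)"
      using nu \<open>\<nu> < 1\<close> unfolding a_def by simp
    also have "\<dots> \<le> 8 / (1 - \<nu>)"
    proof (rule divide_right_mono)
      have "a \<le> 1 - \<nu>" using nu divide_left_mono[of 1 "1 + \<nu>" "1 - \<nu>"] by (simp add: a_def)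
      then show "3 / 2 * (1 + \<nu>) + 4 + 2 * a \<le> 8" using nu by (simp add: field_simps)
    qed (use \<open>\<nu> < 1\<close> in simp)
    finally show "3 / 2 * (1 / a) + (2 / a + 1) * (2 / (1 + \<nu>)) \<le> 8 / (1 - \<nu>)" .
  qed (use B in simp)
  also have "3 / 2 * ln (1 + ?P / tol) \<le> 4 * ln (1 + ?P / tol)"
    using P tol_pos by (intro mult_right_mono) auto
  finally show ?thesis by simp
qed

text \<open>The bound limits the index of a failed test, which forces termination. If
  \<open>n\<close> is the last failed test, then \<open>n + 2\<close> iterations are made, hence the
  constant 3.\<close>

lemma stops_within:
  fixes X :: real
  assumes bound: "\<And>n. active (Suc n) \<Longrightarrow> n \<le> 1 + X" and "0 \<le> X"
  shows "prox_bundle_stops f tol m z" and "inner_iterations f tol m z \<le> 3 + X"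
proof -
  obtain N :: nat where N: "N > 1 + X" using reals_Archimedean2 by blast
  then have "\<not> active (Suc N)" using bound[of N] by auto
  then show stops: "prox_bundle_stops f tol m z"
    by (auto simp: active_def prox_bundle_stops_def not_less)
  define J where "J = (LEAST j. model_error f m z j \<le> tol)"
  have "active J"
    unfolding active_def J_def using not_less_Least not_le by blast
  have "J \<le> 2 + X"
  proof (cases J)
    case (Suc n)
    then show ?thesis using bound[of n] \<open>active J\<close> by simp
  qed (use \<open>0 \<le> X\<close> in simp)
  then show "inner_iterations f tol m z \<le> 3 + X"
    by (simp add: inner_iterations_def J_def)
qed

text \<open>The output is an inexact proximal point: at the stopping step the model is within
  \<open>tol\<close> of \<open>f\<close> at \<open>p\<close>, and it stays below \<open>f\<close> at
  the comparison point.\<close>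

lemma output_properties:
  assumes "prox_bundle_stops f tol m z"
  defines "p \<equiv> prox_bundle_output f tol m z"
  shows "p \<in> effective_domain h"
    and "x \<in> effective_domain h \<Longrightarrow>
      f p + H p - tol + \<rho> / 2 * (norm (x - p))\<^sup>2 \<le> f x + H x + \<rho> / 2 * (norm (x - c))\<^sup>2"
proof -
  define J where "J = (LEAST j. model_error f m z j \<le> tol)"
  have p: "p = z (Suc J)"
    by (simp add: p_def prox_bundle_output_def inner_iterations_def J_def)
  have act: "active J"
    unfolding active_def J_def using not_less_Least not_le by blast
  have err: "model_error f m z J \<le> tol"
    using assms(1) unfolding prox_bundle_stops_def J_def by (rule LeastI_ex)
  show "p \<in> effective_domain h" using z_dom[OF act] p by simp
  show "f p + H p - tol + \<rho> / 2 * (norm (x - p))\<^sup>2 \<le> f x + H x + \<rho> / 2 * (norm (x - c))\<^sup>2"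
    if "x \<in> effective_domain h"
  proof -
    have "0 \<le> \<rho> / 2 * (norm (p - c))\<^sup>2" using rho_pos by simp
    then show ?thesis
      using prox_strong_minimality[OF act that] model_le[OF act, of x] err
      unfolding v_def model_error_def p[symmetric] by linarith
  qed
qed

end

section \<open>The outer iteration\<close>

locale proximal_bundle_method = proper_convex_fun h
  for h :: "'a::euclidean_space \<Rightarrow> ereal" +
  fixes f :: "'a \<Rightarrow> real" and \<rho> \<nu> L \<epsilon> Fmin :: real and y :: "nat \<Rightarrow> 'a"
    and m :: "nat \<Rightarrow> nat \<Rightarrow> 'a \<Rightarrow> real" and z :: "nat \<Rightarrow> nat \<Rightarrow> 'a"
  assumes f_convex: "convex_on UNIV f" and f_smooth: "holder_smooth \<nu> L f"
    and nu: "0 \<le> \<nu>" "\<nu> \<le> 1" and L_pos: "L > 0" and rho_pos: "\<rho> > 0" and eps_pos: "\<epsilon> > 0"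
    and h_lsc: "lower_semicontinuous h"
    and y0_dom: "y 0 \<in> effective_domain h"
    and run: "pbm_run f h \<rho> (y 0) (\<lambda>k. \<epsilon> / 2) y m z"
    and Fmin_le: "x \<in> effective_domain h \<Longrightarrow> Fmin \<le> f x + H x"
    and Fmin_attained: "\<exists>x \<in> effective_domain h. f x + H x = Fmin"
begin

definition gap :: "nat \<Rightarrow> real" where
  "gap k = f (y k) + H (y k) - Fmin"

definition optimal :: "'a set" where
  "optimal = {x \<in> effective_domain h. f x + H x = Fmin}"

abbreviation d0 :: real where
  "d0 \<equiv> infdist (y 0) optimal"

lemma call:
  assumes "outer_generated f (\<lambda>k. \<epsilon> / 2) m z k" "y k \<in> effective_domain h"
  shows "prox_bundle_call h f \<rho> \<nu> L (y k) (\<epsilon> / 2) (m k) (z k)"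
  using run assms f_convex f_smooth nu L_pos rho_pos eps_pos
  by unfold_locales (auto simp: pbm_run_def)

text \<open>Makes the division by \<open>d0\<^sup>2\<close> meaningful and the ceiling positive. By
  lower semicontinuity of \<open>h\<close> and continuity of \<open>f\<close>, each loses less than
  half the initial gap near \<open>y 0\<close>, so no minimizer is close.\<close>

lemma infdist_optimal_pos:
  assumes "gap 0 > 0"
  shows "d0 > 0"
proof -
  define \<delta> where "\<delta> = gap 0 / 2"
  have "ereal (H (y 0) - \<delta>) < h (y 0)" using assms y0_dom by (simp add: h_eq \<delta>_def)
  also have "\<dots> \<le> Liminf (at (y 0)) h" using h_lsc by (simp add: lower_semicontinuous_def)
  finally have "eventually (\<lambda>x. ereal (H (y 0) - \<delta>) < h x) (at (y 0))"
    by (rule less_LiminfD)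
  moreover have "isCont f (y 0)"
    using convex_on_continuous[OF open_UNIV f_convex] by (simp add: continuous_on_eq_continuous_at)
  then have "eventually (\<lambda>x. f (y 0) - \<delta> < f x) (at (y 0))"
    using assms by (intro order_tendstoD(1)) (auto simp: isCont_def \<delta>_def)
  ultimately have "eventually (\<lambda>x. x \<notin> optimal) (at (y 0))"
  proof eventually_elim
    case (elim x)
    show ?case
    proof
      assume "x \<in> optimal"
      then have "x \<in> effective_domain h" "f x + H x = Fmin" by (auto simp: optimal_def)
      with elim have "f (y 0) + H (y 0) - 2 * \<delta> < Fmin" by (simp add: h_eq)
      then show False by (simp add: \<delta>_def gap_def field_simps)
    qed
  qed
  then obtain r where r: "r > 0" "\<And>x. x \<noteq> y 0 \<Longrightarrow> dist x (y 0) < r \<Longrightarrow> x \<notin> optimal"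
    unfolding eventually_at by auto
  have "y 0 \<notin> optimal" using assms by (auto simp: optimal_def gap_def)
  with r have "r \<le> dist (y 0) x" if "x \<in> optimal" for x
    using that by (metis dist_commute not_le)
  moreover have "optimal \<noteq> {}" using Fmin_attained by (auto simp: optimal_def)
  ultimately have "r \<le> d0" unfolding infdist_notempty[OF \<open>optimal \<noteq> {}\<close>] by (intro cINF_greatest)
  with r show ?thesis by simp
qed

text \<open>Serves both ranges of \<open>\<nu>\<close>, which enter only through \<open>base\<close>
  and \<open>coef\<close>. The part of a per-call count that varies with the centre is isolated in
  the logarithm, which is then summed over the outer steps.\<close>

lemma total_bound:
  assumes base: "0 \<le> base" and coef: "0 \<le> coef"
    and calls: "\<And>k. outer_generated f (\<lambda>k. \<epsilon> / 2) m z k \<Longrightarrow> y k \<in> effective_domain h \<Longrightarrow>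
      prox_bundle_stops f (\<epsilon> / 2) (m k) (z k) \<and>
      inner_iterations f (\<epsilon> / 2) (m k) (z k) \<le> base + coef * ln (1 + gap k / (\<epsilon> / 2))"
    and gap0: "\<epsilon> < gap 0"
  shows "\<exists>k. outer_generated f (\<lambda>k. \<epsilon> / 2) m z k \<and> y k \<in> effective_domain h \<and> gap k \<le> \<epsilon> \<and>
    total_inner_iterations f (\<lambda>k. \<epsilon> / 2) m z k
      \<le> \<lceil>\<rho> * d0\<^sup>2 / \<epsilon>\<rceil> * (base + coef * ln (3 + 2 * (gap 0 / (\<rho> * d0\<^sup>2))))"
proof -
  let ?R = "gap 0 / (\<rho> * d0\<^sup>2)"
  have opt_ne: "optimal \<noteq> {}" using Fmin_attained by (auto simp: optimal_def)
  have d0: "d0 > 0" using infdist_optimal_pos gap0 eps_pos by simp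
  have y_Suc: "y (Suc k) = prox_bundle_output f (\<epsilon> / 2) (m k) (z k)"
    if "outer_generated f (\<lambda>k. \<epsilon> / 2) m z k" "prox_bundle_stops f (\<epsilon> / 2) (m k) (z k)" for k
    using run that by (simp add: pbm_run_def)
  \<comment> \<open>Both facts go through one induction: termination of the next call is available
    only once its centre is known to be generated and in the domain.\<close>
  have gen: "outer_generated f (\<lambda>k. \<epsilon> / 2) m z k \<and> y k \<in> effective_domain h" for k
  proof (induction k)
    case 0
    show ?case using y0_dom by (simp add: outer_generated_def)
  next
    case (Suc k)
    then interpret prox_bundle_call h f \<rho> \<nu> L "y k" "\<epsilon> / 2" "m k" "z k" by (intro call) auto
    have stops: "prox_bundle_stops f (\<epsilon> / 2) (m k) (z k)" using calls Suc by blast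
    with Suc have "outer_generated f (\<lambda>k. \<epsilon> / 2) m z (Suc k)"
      by (auto simp: outer_generated_def less_Suc_eq)
    with y_Suc[of k] Suc stops output_properties(1) show ?case by simp
  qed
  have gap_nonneg: "0 \<le> gap k" for k using Fmin_le gen[of k] by (simp add: gap_def)
  have descent: "2 * gap (Suc k) - \<epsilon> \<le> \<rho> * (norm (x - y k))\<^sup>2 - \<rho> * (norm (x - y (Suc k)))\<^sup>2"
    if "x \<in> optimal" for x k
  proof -
    interpret prox_bundle_call h f \<rho> \<nu> L "y k" "\<epsilon> / 2" "m k" "z k" using gen by (intro call) auto
    have stops: "prox_bundle_stops f (\<epsilon> / 2) (m k) (z k)" using calls gen by blast
    show ?thesis
      using output_properties(2)[OF stops, of x] that y_Suc[OF _ stops] gen[of k]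
      by (simp add: optimal_def gap_def field_simps)
  qed
  have sum_gap: "(\<Sum>k<K. 2 * gap (Suc k) - \<epsilon>) \<le> \<rho> * d0\<^sup>2" for K
  proof -
    \<comment> \<open>The square root turns the estimate into a lower bound for every distance to a
      minimizer, which passes to the infimum without a nearest point.\<close>
    have "sqrt ((\<Sum>k<K. 2 * gap (Suc k) - \<epsilon>) / \<rho>) \<le> dist (y 0) x" if "x \<in> optimal" for x
    proof -
      have "(\<Sum>k<K. 2 * gap (Suc k) - \<epsilon>)
          \<le> (\<Sum>k<K. \<rho> * (norm (x - y k))\<^sup>2 - \<rho> * (norm (x - y (Suc k)))\<^sup>2)"
        by (intro sum_mono descent that)
      also have "\<dots> = \<rho> * (norm (x - y 0))\<^sup>2 - \<rho> * (norm (x - y K))\<^sup>2"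
        by (rule sum_lessThan_telescope')
      also have "\<dots> \<le> \<rho> * (dist (y 0) x)\<^sup>2"
        using rho_pos by (simp add: dist_norm norm_minus_commute)
      finally have "(\<Sum>k<K. 2 * gap (Suc k) - \<epsilon>) / \<rho> \<le> (dist (y 0) x)\<^sup>2"
        using rho_pos by (simp add: field_simps)
      then show ?thesis by (intro real_le_lsqrt) auto
    qed
    then have "sqrt ((\<Sum>k<K. 2 * gap (Suc k) - \<epsilon>) / \<rho>) \<le> d0"
      unfolding infdist_notempty[OF opt_ne] using opt_ne by (intro cINF_greatest)
    then have "(\<Sum>k<K. 2 * gap (Suc k) - \<epsilon>) / \<rho> \<le> d0\<^sup>2" by (rule sqrt_le_D)
    then show ?thesis using rho_pos by (simp add: field_simps)
  qed
  define N where "N = \<lceil>\<rho> * d0\<^sup>2 / \<epsilon>\<rceil>"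
  have N_pos: "N > 0" using rho_pos d0 eps_pos by (simp add: N_def)
  have N_ge: "\<rho> * d0\<^sup>2 \<le> N * \<epsilon>"
    using le_of_int_ceiling[of "\<rho> * d0\<^sup>2 / \<epsilon>"] unfolding N_def pos_divide_le_eq[OF eps_pos] .
  have "\<exists>k. k \<le> nat N \<and> gap k \<le> \<epsilon>"
  proof (rule ccontr)
    assume "\<not> ?thesis"
    \<comment> \<open>Each summand \<open>2 * gap (Suc k) - \<epsilon>\<close> would then exceed
      \<open>\<epsilon>\<close>, and their sum would exceed
      \<open>N * \<epsilon> \<ge> \<rho> * d0\<^sup>2\<close>.\<close>
    then have "\<epsilon> < gap (Suc k)" if "k < nat N" for k using that by (meson Suc_leI not_le)
    then have "(\<Sum>k<nat N. \<epsilon>) < (\<Sum>k<nat N. 2 * gap (Suc k) - \<epsilon>)"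
      using N_pos by (intro sum_strict_mono) (auto simp: lessThan_empty_iff)
    with sum_gap[of "nat N"] N_ge N_pos show False by simp
  qed
  then obtain k where k: "k \<le> nat N" "gap k \<le> \<epsilon>" by blast
  define K where "K = (LEAST k. gap k \<le> \<epsilon>)"
  have K: "gap K \<le> \<epsilon>" unfolding K_def by (rule LeastI) (rule k)
  have "K \<le> k" unfolding K_def using k by (intro Least_le)
  with k N_pos have K_N: "real K \<le> N" by linarith
  have "K \<noteq> 0" using K gap0 by (intro notI) simp
  then obtain K' where K': "K = Suc K'" by (cases K) auto
  have sum_scaled: "(\<Sum>k<K. gap k / (\<epsilon> / 2)) \<le> N * ((3 + 2 * ?R) - 1)"
  proof -
    have "(\<Sum>k<K. gap k / (\<epsilon> / 2)) = (\<Sum>k<K. 2 * gap k) / \<epsilon>"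
      by (simp add: sum_divide_distrib mult.commute)
    \<comment> \<open>The descent estimate controls only gaps after a step, so \<open>gap 0\<close>
      is split off and yields \<open>2 * ?R\<close>. The other two terms contribute at most
      \<open>N * \<epsilon>\<close> each, which gives \<open>3 + 2 * ?R\<close> in the
      logarithm.\<close>
    also have "(\<Sum>k<K. 2 * gap k) = 2 * gap 0 + (\<Sum>k<K'. 2 * gap (Suc k) - \<epsilon>) + K' * \<epsilon>"
      unfolding K' by (subst sum.lessThan_Suc_shift) (simp add: sum_subtractf)
    also have "\<dots> \<le> 2 * gap 0 + \<rho> * d0\<^sup>2 + N * \<epsilon>"
    proof -
      have "K' * \<epsilon> \<le> N * \<epsilon>" using K_N K' eps_pos by (intro mult_right_mono) auto
      with sum_gap[of K'] show ?thesis by linarith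
    qed
    also have "\<dots> \<le> 2 * (N * \<epsilon> * ?R) + N * \<epsilon> + N * \<epsilon>"
    proof -
      have "gap 0 = \<rho> * d0\<^sup>2 * ?R" using rho_pos d0 by simp
      also have "\<dots> \<le> N * \<epsilon> * ?R"
        using N_ge gap_nonneg[of 0] rho_pos by (intro mult_right_mono) auto
      finally show ?thesis using N_ge by linarith
    qed
    also have "\<dots> = N * ((3 + 2 * ?R) - 1) * \<epsilon>" by (simp add: algebra_simps)
    finally show ?thesis using eps_pos by (simp add: divide_right_mono)
  qed
  have "(\<Sum>k<K. ln (1 + gap k / (\<epsilon> / 2))) \<le> N * ln (3 + 2 * ?R)"
    using gap_nonneg eps_pos K_N sum_scaled gap_nonneg[of 0] rho_pos
    by (intro sum_ln_add_one_le) auto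
  then have "coef * (\<Sum>k<K. ln (1 + gap k / (\<epsilon> / 2))) \<le> coef * (N * ln (3 + 2 * ?R))"
    using coef by (rule mult_left_mono)
  moreover have "K * base \<le> N * base" using K_N base by (rule mult_right_mono)
  moreover have "real (total_inner_iterations f (\<lambda>k. \<epsilon> / 2) m z K)
      \<le> (\<Sum>k<K. base + coef * ln (1 + gap k / (\<epsilon> / 2)))"
    unfolding total_inner_iterations_def of_nat_sum using calls gen by (intro sum_mono) blast
  ultimately have "real (total_inner_iterations f (\<lambda>k. \<epsilon> / 2) m z K)
      \<le> N * (base + coef * ln (3 + 2 * ?R))"
    by (simp add: sum.distrib sum_distrib_left algebra_simps)
  with K gen[of K] show ?thesis unfolding N_def by blast
qed

end

section \<open>The complexity bounds for the extended-valued objective\<close>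

theorem theorem3:
  fixes f :: "real ^ 'n \<Rightarrow> real"
    and h :: "real ^ 'n \<Rightarrow> ereal"
    and F :: "real ^ 'n \<Rightarrow> ereal"
    and \<nu> L \<rho> \<epsilon> d0 \<Phi>0 R0 :: real
    and y0 :: "real ^ 'n"
    and y :: "nat \<Rightarrow> real ^ 'n"
    and m :: "nat \<Rightarrow> nat \<Rightarrow> real ^ 'n \<Rightarrow> real"
    and z :: "nat \<Rightarrow> nat \<Rightarrow> real ^ 'n"
  assumes F_eq: "F = composite f h"
    and f_convex: "convex_on UNIV f"
    and h_proper: "proper_fun h"
    and h_lsc: "lower_semicontinuous h"
    and h_convex: "convex_ereal h"
    and F_attains_min: "minimizers F \<noteq> {}"
    and nu: "0 \<le> \<nu>" "\<nu> \<le> 1"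
    and L_pos: "L > 0"
    and f_smooth: "holder_smooth \<nu> L f"
    and y0_dom: "y0 \<in> effective_domain F"
    and rho_pos: "\<rho> > 0"
    and eps: "0 < \<epsilon>" "ereal \<epsilon> < F y0 - min_value F"
    and run: "pbm_run f h \<rho> y0 (\<lambda>k. \<epsilon> / 2) y m z"
    and d0_eq: "d0 = infdist y0 (minimizers F)"
    and Phi0_eq: "\<Phi>0 = real_of_ereal (F y0 - min_value F)"
    and R0_eq: "R0 = \<Phi>0 / (\<rho> * d0\<^sup>2)"
  shows "\<exists>k. outer_generated f (\<lambda>k. \<epsilon> / 2) m z k \<and>
    F (y k) - min_value F \<le> ereal \<epsilon> \<and>
    (\<nu> = 1 \<longrightarrow>
      real (total_inner_iterations f (\<lambda>k. \<epsilon> / 2) m z k) \<le>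
        of_int \<lceil>\<rho> * d0\<^sup>2 / \<epsilon>\<rceil> *
        (3 + (2 * ln (1 + L / \<rho>) + ln (3 + 2 * R0)) / ln (1 + \<rho> / L))) \<and>
    (\<nu> < 1 \<longrightarrow>
      real (total_inner_iterations f (\<lambda>k. \<epsilon> / 2) m z k) \<le>
        of_int \<lceil>\<rho> * d0\<^sup>2 / \<epsilon>\<rceil> *
        (3 + 4 * ln (3 + 2 * R0) +
          8 / (1 - \<nu>) * (2 / (1 + \<nu>)) powr ((1 - \<nu>) / (1 + \<nu>)) *
            (L powr (2 / (1 + \<nu>)) / (\<rho> * \<epsilon> powr ((1 - \<nu>) / (1 + \<nu>))))))"
proof -
  interpret proper_convex_fun h
    using h_proper h_convex by unfold_locales
  have F_dom: "F x = ereal (f x + H x)" if "x \<in> effective_domain h" for x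
    using that by (simp add: F_eq composite_def h_eq)
  have F_out: "F x = \<infinity>" if "x \<notin> effective_domain h" for x
    using that by (simp add: F_eq composite_def h_outside)
  have y0: "y0 \<in> effective_domain h"
    using y0_dom F_out[of y0] by (auto simp: effective_domain_def)
  obtain xs where xs: "F xs = min_value F" using F_attains_min by (auto simp: minimizers_def)
  have min_le: "min_value F \<le> F x" for x unfolding min_value_def by (rule INF_lower) simp
  \<comment> \<open>Since \<open>F\<close> is finite at \<open>y0\<close>, so is its minimum; from
    here on the argument uses real values.\<close>
  have xs_dom: "xs \<in> effective_domain h"
    using F_out[of xs] F_dom[OF y0] min_le[of y0] by (cases "xs \<in> effective_domain h") (auto simp: xs)
  define Fmin where "Fmin = f xs + H xs"
  have Fmin: "min_value F = ereal Fmin" using F_dom[OF xs_dom] xs by (simp add: Fmin_def)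
  have run_y0: "y 0 = y0" using run by (simp add: pbm_run_def)
  interpret pbm: proximal_bundle_method h f \<rho> \<nu> L \<epsilon> Fmin y m z
  proof unfold_locales
    show "Fmin \<le> f x + H x" if "x \<in> effective_domain h" for x
      using min_le[of x] F_dom[OF that] Fmin by simp
    show "\<exists>x\<in>effective_domain h. f x + H x = Fmin" using xs_dom Fmin_def by blast
  qed (use f_convex f_smooth nu L_pos rho_pos eps h_lsc y0 run run_y0 in auto)
  have "x \<in> minimizers F \<longleftrightarrow> x \<in> pbm.optimal" for x
    using F_dom[of x] F_out[of x]
    by (cases "x \<in> effective_domain h") (auto simp: minimizers_def pbm.optimal_def Fmin)
  then have "minimizers F = pbm.optimal" by blast
  then have d0: "d0 = pbm.d0" by (simp add: d0_eq run_y0)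
  have gap: "F (y k) - min_value F = ereal (pbm.gap k)" if "y k \<in> effective_domain h" for k
    using F_dom[OF that] by (simp add: pbm.gap_def Fmin)
  have \<Phi>0: "\<Phi>0 = pbm.gap 0" using gap[of 0] y0 by (simp add: Phi0_eq run_y0)
  have gap0: "\<epsilon> < pbm.gap 0" using eps(2) gap[of 0] y0 by (simp add: run_y0)
  have gap_ratio: "0 \<le> pbm.gap k / (\<epsilon> / 2)" if "y k \<in> effective_domain h" for k
    using pbm.Fmin_le[OF that] eps by (simp add: pbm.gap_def)
  show ?thesis
  proof (cases "\<nu> = 1")
    case True
    have ln_pos: "0 < ln (1 + \<rho> / L)" "0 \<le> ln (1 + L / \<rho>)"
      using rho_pos L_pos by (auto intro!: ln_gt_zero)
    \<comment> \<open>The quotient is split so that only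
      \<open>ln (1 + pbm.gap k / (\<epsilon> / 2))\<close> varies with \<open>k\<close>, with
      \<open>1 / ln (1 + \<rho> / L)\<close> as \<open>coef\<close>.\<close>
    have "prox_bundle_stops f (\<epsilon> / 2) (m k) (z k) \<and>
        inner_iterations f (\<epsilon> / 2) (m k) (z k)
          \<le> (3 + 2 * ln (1 + L / \<rho>) / ln (1 + \<rho> / L))
            + 1 / ln (1 + \<rho> / L) * ln (1 + pbm.gap k / (\<epsilon> / 2))"
      if k: "outer_generated f (\<lambda>k. \<epsilon> / 2) m z k" "y k \<in> effective_domain h" for k
    proof -
      interpret prox_bundle_call h f \<rho> \<nu> L "y k" "\<epsilon> / 2" "m k" "z k" using k by (rule pbm.call)
      let ?X = "(2 * ln (1 + L / \<rho>) + ln (1 + pbm.gap k / (\<epsilon> / 2))) / ln (1 + \<rho> / L)"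
      have bound: "n \<le> 1 + ?X" if "active (Suc n)" for n
        using smooth_active_bound[OF True pbm.Fmin_le that] unfolding pbm.gap_def by simp
      have "0 \<le> ?X" using ln_pos gap_ratio[OF k(2)] by simp
      from stops_within[OF bound this] show ?thesis by (simp add: add_divide_distrib)
    qed
    from pbm.total_bound[OF _ _ this gap0] ln_pos
    obtain k where k: "outer_generated f (\<lambda>k. \<epsilon> / 2) m z k" "y k \<in> effective_domain h"
      "pbm.gap k \<le> \<epsilon>"
      "real (total_inner_iterations f (\<lambda>k. \<epsilon> / 2) m z k) \<le> \<lceil>\<rho> * d0\<^sup>2 / \<epsilon>\<rceil> *
        ((3 + 2 * ln (1 + L / \<rho>) / ln (1 + \<rho> / L)) + 1 / ln (1 + \<rho> / L) * ln (3 + 2 * R0))"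
      unfolding d0 R0_eq \<Phi>0 by auto
    have eq: "(3 + 2 * ln (1 + L / \<rho>) / ln (1 + \<rho> / L)) + 1 / ln (1 + \<rho> / L) * ln (3 + 2 * R0)
        = 3 + (2 * ln (1 + L / \<rho>) + ln (3 + 2 * R0)) / ln (1 + \<rho> / L)"
      by (simp add: add_divide_distrib)
    from k(1,3) k(4)[unfolded eq] True gap[OF k(2)] show ?thesis by (intro exI[of _ k]) simp
  next
    case False
    then have "\<nu> < 1" using nu by simp
    \<comment> \<open>The same quantity as in \<open>holder_active_bound\<close>, as
      \<open>2 * (\<epsilon> / 2) = \<epsilon>\<close>. It is independent of the centre and goes
      into \<open>base\<close>.\<close>
    define B where "B = (2 / (1 + \<nu>)) powr ((1 - \<nu>) / (1 + \<nu>)) *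
      (L powr (2 / (1 + \<nu>)) / (\<rho> * \<epsilon> powr ((1 - \<nu>) / (1 + \<nu>))))"
    have B: "0 \<le> 8 / (1 - \<nu>) * B" using \<open>\<nu> < 1\<close> rho_pos by (simp add: B_def)
    have "prox_bundle_stops f (\<epsilon> / 2) (m k) (z k) \<and>
        inner_iterations f (\<epsilon> / 2) (m k) (z k)
          \<le> (3 + 8 / (1 - \<nu>) * B) + 4 * ln (1 + pbm.gap k / (\<epsilon> / 2))"
      if k: "outer_generated f (\<lambda>k. \<epsilon> / 2) m z k" "y k \<in> effective_domain h" for k
    proof -
      interpret prox_bundle_call h f \<rho> \<nu> L "y k" "\<epsilon> / 2" "m k" "z k" using k by (rule pbm.call)
      let ?X = "4 * ln (1 + pbm.gap k / (\<epsilon> / 2)) + 8 / (1 - \<nu>) * B"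
      have bound: "n \<le> 1 + ?X" if "active (Suc n)" for n
        using holder_active_bound[OF \<open>\<nu> < 1\<close> pbm.Fmin_le that]
        unfolding pbm.gap_def B_def by simp
      have "0 \<le> ?X" using B gap_ratio[OF k(2)] by (intro add_nonneg_nonneg) auto
      from stops_within[OF bound this] show ?thesis by simp
    qed
    from pbm.total_bound[OF _ _ this gap0] B
    obtain k where k: "outer_generated f (\<lambda>k. \<epsilon> / 2) m z k" "y k \<in> effective_domain h"
      "pbm.gap k \<le> \<epsilon>"
      "real (total_inner_iterations f (\<lambda>k. \<epsilon> / 2) m z k) \<le> \<lceil>\<rho> * d0\<^sup>2 / \<epsilon>\<rceil> *
        ((3 + 8 / (1 - \<nu>) * B) + 4 * ln (3 + 2 * R0))"
      unfolding d0 R0_eq \<Phi>0 by auto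
    have eq: "(3 + 8 / (1 - \<nu>) * B) + 4 * ln (3 + 2 * R0) = 3 + 4 * ln (3 + 2 * R0)
        + 8 / (1 - \<nu>) * (2 / (1 + \<nu>)) powr ((1 - \<nu>) / (1 + \<nu>)) *
            (L powr (2 / (1 + \<nu>)) / (\<rho> * \<epsilon> powr ((1 - \<nu>) / (1 + \<nu>))))"
      by (simp add: B_def)
    from k(1,3) k(4)[unfolded eq] False gap[OF k(2)] show ?thesis by (intro exI[of _ k]) simp
  qed
qed

end
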